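(* Assume that there exist four or more (pairwise distinct) states $x_0,x_1^1,\dots,x_1^n,x_2\in\mathcal{X}$, $n\in\mathbb{N}$, such that $\mathcal{X}^s=\{x_0\}$, $\mathcal{X}^m=\{x_1^1,\dots,x_1^n,x_2\}$, and $H(x_2)>H(x_1^r)$, $H(x_1^r)=H(x_1^q)$, $\Phi(x_1^r,x_1^q)-H(x_1^r)<\Gamma_m$ for every $r,q=1,\dots,n$. Assume that $$\lim_{\beta\to\infty}\mathbb{P}_{x_2}(\tau_{x_0}<\tau_{x_1^r})=0\qquad\text{for every } r=1,\dots,n,$$ and that there exist two positive constants $k_1,k_2<\infty$ such that, as $\beta\to\infty$, $$\frac{\mu_\beta(x_2)}{\mathrm{cap}_\beta(x_2,\{x_1^1,\dots,x_1^n,x_0\})}=\frac1{k_1}e^{\beta\Gamma_m}[1+o(1)],\qquad \frac{\mu_\beta(\{x_1^1,\dots,x_1^n\})}{\mathrm{cap}_\beta(\{x_1^1,\dots,x_1^n\},x_0)}=\frac1{k_2}e^{\beta\Gamma_m}[1+o(1)].$$ Then, as $\beta\to\infty$, $$\mathbb{E}_{x_2}[\tau_{x_0}]=e^{\beta\Gamma_m}\Big(\frac1{k_1}+\frac1{k_2}\Big)[1+o(1)].$$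
   Context: $\mathcal{X}$ is a finite set and $\Delta:\mathcal{X}\times\mathcal{X}\to\mathbb{R}^+\cup\{\infty\}$ (nonnegative values, $0$ allowed) is an irreducible rate function: for all $x,y\in\mathcal{X}$ there is a finite sequence $\omega_1=x,\dots,\omega_n=y$ with $\Delta(\omega_i,\omega_{i+1})<\infty$ for all $i$. For each $\beta>0$, $(X_n)_{n\in\mathbb{N}}$ is a time-homogeneous Markov chain on $\mathcal{X}$ with transition matrix $\mathcal{P}_\beta$, and $\lim_{\beta\to\infty}-\frac{\log\mathcal{P}_\beta(x,y)}{\beta}=\Delta(x,y)$ for all $x,y$. Detailed balance holds: $\mathcal{P}_\beta(x,y)e^{-\beta G(x)}=\mathcal{P}_\beta(y,x)e^{-\beta G(y)}$, where $G:\mathcal{X}\to\mathbb{R}$ is the Hamiltonian (possibly depending on $\beta$). The Gibbs measure is $\mu_\beta(x)=e^{-\beta G(x)}/\sum_{y\in\mathcal{X}}e^{-\beta G(y)}$. The virtual energy is $H(x):=\lim_{\beta\to\infty}G(x)$. The transition energy is $H(x,y):=H(x)+\Delta(x,y)$. A path is a finite sequence $\omega=(\omega_1,\dots,\omega_n)$ in $\mathcal{X}$; its height is $\Phi_\omega=H(\omega_1)$ if $|\omega|=1$ and $\Phi_\omega=\max_{i<|\omega|}H(\omega_i,\omega_{i+1})$ if $|\omega|>1$. The communication height is $\Phi(x,y):=\min_{\omega}\Phi_\omega$ over all paths from $x$ to $y$, and $\Phi(A,B):=\min_{x\in A,y\in B}\Phi(x,y)$ for sets. Let $\mathcal{I}_x:=\{y\mid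 H(y)<H(x)\}$ and $V_x:=\Phi(x,\mathcal{I}_x)-H(x)$, with $V_x=\infty$ if $\mathcal{I}_x=\emptyset$. $\mathcal{X}^s$ is the set of global minima of $H$, $\Gamma_m:=\max_{x\in\mathcal{X}\setminus\mathcal{X}^s}V_x$ and $\mathcal{X}^m:=\{y\in\mathcal{X}\mid V_y=\Gamma_m\}$. The Dirichlet form is $\mathscr{D}_\beta[f]:=\frac12\sum_{y,z\in\mathcal{X}}\mu_\beta(y)\mathcal{P}_\beta(y,z)[f(y)-f(z)]^2$. For nonempty disjoint $Y,Z\subset\mathcal{X}$, $\mathrm{cap}_\beta(Y,Z):=\min\{\mathscr{D}_\beta[f]: f:\mathcal{X}\to[0,1],\ f|_Y=1,\ f|_Z=0\}$; singletons are written without braces. $\tau_A:=\inf\{t>0\mid X_t\in A\}$ is the first hitting time of $A$; $\mathbb{P}_x$ and $\mathbb{E}_x$ are probability and expectation for the chain started at $x$. *)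

theory Defs
  imports "HOL-Probability.Probability" "HOL-Library.Landau_Symbols"
begin

text \<open>The finite state space is the universe of a type of class \<open>finite\<close>. Rate functions,
  heights and depths may be infinite, hence extended reals; the virtual energy is real.\<close>

type_synonym 'a rate = "'a \<Rightarrow> 'a \<Rightarrow> ereal"


subsection \<open>Markov chains\<close>

definition stochastic_matrix :: "('a::finite \<Rightarrow> 'a \<Rightarrow> real) \<Rightarrow> bool" where
  "stochastic_matrix p \<longleftrightarrow> (\<forall>x y. 0 \<le> p x y) \<and> (\<forall>x. (\<Sum>y\<in>UNIV. p x y) = 1)"

text \<open>\<open>M\<close> is an arbitrary probability space carrying the chain \<open>X\<close>, which is started at \<open>x\<close> and
  has transition matrix \<open>p\<close>; so \<open>M\<close> plays the role of the law \<open>P\<^sub>x\<close>.\<close>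

definition markov_chain_from ::
    "'w measure \<Rightarrow> (nat \<Rightarrow> 'w \<Rightarrow> 'a::finite) \<Rightarrow> ('a \<Rightarrow> 'a \<Rightarrow> real) \<Rightarrow> 'a \<Rightarrow> bool" where
  "markov_chain_from M X p x \<longleftrightarrow>
     prob_space M \<and>
     (\<forall>n. X n \<in> measurable M (count_space UNIV)) \<and>
     \<P>(w in M. X 0 w = x) = 1 \<and>
     (\<forall>n s y. \<P>(w in M. \<forall>i\<le>n. X i w = s i) > 0 \<longrightarrow>
        \<P>(w in M. X (Suc n) w = y \<bar> \<forall>i\<le>n. X i w = s i) = p (s n) y)"

text \<open>The infimum of the empty set is \<open>\<infinity>\<close> in \<open>enat\<close>.\<close>

definition hitting_time :: "(nat \<Rightarrow> 'w \<Rightarrow> 'a) \<Rightarrow> 'a set \<Rightarrow> 'w \<Rightarrow> enat" where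
  "hitting_time X A w = Inf (enat ` {t. t > 0 \<and> X t w \<in> A})"

definition expected_hitting_time :: "'w measure \<Rightarrow> (nat \<Rightarrow> 'w \<Rightarrow> 'a) \<Rightarrow> 'a set \<Rightarrow> ennreal" where
  "expected_hitting_time M X A = (\<integral>\<^sup>+ w. ennreal_of_enat (hitting_time X A w) \<partial>M)"


subsection \<open>Rare transitions\<close>

text \<open>\<open>- log p / \<beta>\<close> with the convention \<open>- log 0 = \<infinity>\<close>.\<close>

definition log_rate :: "real \<Rightarrow> real \<Rightarrow> ereal" where
  "log_rate \<beta> p = (if p = 0 then \<infinity> else ereal (- ln p / \<beta>))"

definition path_between :: "'a \<Rightarrow> 'a \<Rightarrow> 'a list \<Rightarrow> bool" where
  "path_between x y \<omega> \<longleftrightarrow> \<omega> \<noteq> [] \<and> hd \<omega> = x \<and> last \<omega> = y"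

definition irreducible_rate :: "'a rate \<Rightarrow> bool" where
  "irreducible_rate \<Delta> \<longleftrightarrow>
     (\<forall>x y. \<exists>\<omega>. path_between x y \<omega> \<and> (\<forall>i. Suc i < length \<omega> \<longrightarrow> \<Delta> (\<omega> ! i) (\<omega> ! Suc i) < \<infinity>))"

text \<open>The data are indexed by the inverse temperature \<open>\<beta>\<close>: \<open>P \<beta>\<close> is the transition matrix, \<open>G \<beta>\<close>
  the Hamiltonian and \<open>M \<beta> x\<close>, \<open>X \<beta>\<close> a realization of the chain started at \<open>x\<close>. \<open>H\<close> is the
  virtual energy.\<close>

locale rare_transitions =
  fixes \<Delta> :: "'a::finite rate"
    and P :: "real \<Rightarrow> 'a \<Rightarrow> 'a \<Rightarrow> real"
    and G :: "real \<Rightarrow> 'a \<Rightarrow> real"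
    and H :: "'a \<Rightarrow> real"
    and M :: "real \<Rightarrow> 'a \<Rightarrow> 'w measure"
    and X :: "real \<Rightarrow> nat \<Rightarrow> 'w \<Rightarrow> 'a"
  assumes rate_nonneg: "0 \<le> \<Delta> x y"
    and rate_irreducible: "irreducible_rate \<Delta>"
    and stochastic: "\<beta> > 0 \<Longrightarrow> stochastic_matrix (P \<beta>)"
    and rate_limit: "((\<lambda>\<beta>. log_rate \<beta> (P \<beta> x y)) \<longlongrightarrow> \<Delta> x y) at_top"
    and detailed_balance:
      "\<beta> > 0 \<Longrightarrow> P \<beta> x y * exp (- \<beta> * G \<beta> x) = P \<beta> y x * exp (- \<beta> * G \<beta> y)"
    and virtual_energy: "((\<lambda>\<beta>. G \<beta> x) \<longlongrightarrow> H x) at_top"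
    and chain: "\<beta> > 0 \<Longrightarrow> markov_chain_from (M \<beta> x) (X \<beta>) (P \<beta>) x"


subsection \<open>Energy landscape\<close>

definition transition_energy :: "('a \<Rightarrow> real) \<Rightarrow> 'a rate \<Rightarrow> 'a \<Rightarrow> 'a \<Rightarrow> ereal" where
  "transition_energy H \<Delta> x y = ereal (H x) + \<Delta> x y"

definition path_height :: "('a \<Rightarrow> real) \<Rightarrow> 'a rate \<Rightarrow> 'a list \<Rightarrow> ereal" where
  "path_height H \<Delta> \<omega> =
     (if length \<omega> = 1 then ereal (H (hd \<omega>))
      else Max {transition_energy H \<Delta> (\<omega> ! i) (\<omega> ! Suc i) | i. Suc i < length \<omega>})"

text \<open>On a finite state space path heights take finitely many values, so the infima below are
  minima (for nonempty sets).\<close>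

definition comm_height :: "('a \<Rightarrow> real) \<Rightarrow> 'a rate \<Rightarrow> 'a \<Rightarrow> 'a \<Rightarrow> ereal" where
  "comm_height H \<Delta> x y = (INF \<omega>\<in>{\<omega>. path_between x y \<omega>}. path_height H \<Delta> \<omega>)"

definition comm_height_sets :: "('a \<Rightarrow> real) \<Rightarrow> 'a rate \<Rightarrow> 'a set \<Rightarrow> 'a set \<Rightarrow> ereal" where
  "comm_height_sets H \<Delta> A B = (INF x\<in>A. INF y\<in>B. comm_height H \<Delta> x y)"

definition lower_states :: "('a \<Rightarrow> real) \<Rightarrow> 'a \<Rightarrow> 'a set" where
  "lower_states H x = {y. H y < H x}"

definition stability_level :: "('a \<Rightarrow> real) \<Rightarrow> 'a rate \<Rightarrow> 'a \<Rightarrow> ereal" where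
  "stability_level H \<Delta> x =
     (if lower_states H x = {} then \<infinity>
      else comm_height_sets H \<Delta> {x} (lower_states H x) - ereal (H x))"

definition stable_states :: "('a \<Rightarrow> real) \<Rightarrow> 'a set" where
  "stable_states H = {x. \<forall>y. H x \<le> H y}"

definition max_stability_level :: "('a::finite \<Rightarrow> real) \<Rightarrow> 'a rate \<Rightarrow> ereal" where
  "max_stability_level H \<Delta> = Max (stability_level H \<Delta> ` (UNIV - stable_states H))"

definition metastable_states :: "('a::finite \<Rightarrow> real) \<Rightarrow> 'a rate \<Rightarrow> 'a set" where
  "metastable_states H \<Delta> = {y. stability_level H \<Delta> y = max_stability_level H \<Delta>}"


subsection \<open>Gibbs measure and capacity\<close>

definition gibbs :: "real \<Rightarrow> ('a::finite \<Rightarrow> real) \<Rightarrow> 'a set \<Rightarrow> real" where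
  "gibbs \<beta> g A = (\<Sum>x\<in>A. exp (- \<beta> * g x) / (\<Sum>y\<in>UNIV. exp (- \<beta> * g y)))"

definition dirichlet_form ::
    "real \<Rightarrow> ('a::finite \<Rightarrow> real) \<Rightarrow> ('a \<Rightarrow> 'a \<Rightarrow> real) \<Rightarrow> ('a \<Rightarrow> real) \<Rightarrow> real" where
  "dirichlet_form \<beta> g p f =
     1 / 2 * (\<Sum>y\<in>UNIV. \<Sum>z\<in>UNIV. gibbs \<beta> g {y} * p y z * (f y - f z)\<^sup>2)"

text \<open>The infimum is a minimum for disjoint \<open>Y\<close> and \<open>Z\<close>: a continuous function is minimized over a
  nonempty compact set.\<close>

definition cap ::
    "real \<Rightarrow> ('a::finite \<Rightarrow> real) \<Rightarrow> ('a \<Rightarrow> 'a \<Rightarrow> real) \<Rightarrow> 'a set \<Rightarrow> 'a set \<Rightarrow> real" where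
  "cap \<beta> g p Y Z =
     (INF f\<in>{f. (\<forall>x. 0 \<le> f x \<and> f x \<le> 1) \<and> (\<forall>y\<in>Y. f y = 1) \<and> (\<forall>z\<in>Z. f z = 0)}.
        dirichlet_form \<beta> g p f)"

end

theory Submission
  imports Defs
begin

text \<open>Write \<open>A = {x\<^sub>1\<^sup>1, \<dots>, x\<^sub>1\<^sup>n}\<close>. The time to reach \<open>x0\<close> from \<open>x2\<close> splits at the hitting time of
  \<open>A \<union> {x0}\<close>; since the chain enters this set through \<open>A\<close> with probability tending to 1, the mean is
  asymptotically the sum of the mean time from \<open>x2\<close> to \<open>A \<union> {x0}\<close> and the mean time from \<open>A\<close> to
  \<open>x0\<close>. For a reversible chain, the mean hitting time of \<open>T\<close>, averaged over the
  normalized equilibrium charge of \<open>S\<close>, times the capacity of \<open>(S, T)\<close> is the Gibbs mass of the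
  equilibrium potential. For the two pairs at hand this mass is concentrated on \<open>S\<close>: a state \<open>y\<close> that is
  not higher than \<open>S\<close> reaches \<open>T\<close> over a barrier smaller than \<open>\<Gamma>\<^sub>m\<close>, but \<open>S\<close> only over a level
  \<open>\<Gamma>\<^sub>m\<close> above \<open>S\<close>, and the equilibrium potential at \<open>y\<close> is bounded by a quotient of capacities. The average
  over the charge of \<open>A\<close> is harmless because the states of \<open>A\<close> communicate below \<open>\<Gamma>\<^sub>m\<close>, so their mean
  hitting times of \<open>x0\<close> differ by \<open>o(e\<^sup>\<beta>\<^sup>\<Gamma>)\<close>.

  Mean hitting times and equilibrium potentials are introduced as solutions of Dirichlet
  problems. This is consistent with hitting times that exclude time 0, as long as the chain starts
  outside the target set.\<close>

subsection \<open>Potential theory of finite reversible chains\<close>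

text \<open>The sign is that of the identity minus \<open>p\<close>, so superharmonic functions are
  those with nonnegative \<open>laplacian\<close>.\<close>

definition laplacian :: "('a::finite \<Rightarrow> 'a \<Rightarrow> real) \<Rightarrow> ('a \<Rightarrow> real) \<Rightarrow> 'a \<Rightarrow> real" where
  "laplacian p u x = u x - (\<Sum>y\<in>UNIV. p x y * u y)"

text \<open>For irreducible \<open>p\<close> and nonempty \<open>D\<close> the choice by
  \<open>SOME\<close> is justified by \<open>dirichlet_problem_solvable\<close>, and
  \<open>comparison\<close> makes the solution unique.\<close>

definition dirichlet_solution ::
    "('a::finite \<Rightarrow> 'a \<Rightarrow> real) \<Rightarrow> 'a set \<Rightarrow> ('a \<Rightarrow> real) \<Rightarrow> ('a \<Rightarrow> real) \<Rightarrow> 'a \<Rightarrow> real" where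
  "dirichlet_solution p D f g =
     (SOME u. (\<forall>x\<in>D. u x = g x) \<and> (\<forall>x. x \<notin> D \<longrightarrow> laplacian p u x = f x))"

definition mean_hitting :: "('a::finite \<Rightarrow> 'a \<Rightarrow> real) \<Rightarrow> 'a set \<Rightarrow> 'a \<Rightarrow> real" where
  "mean_hitting p D = dirichlet_solution p D (\<lambda>_. 1) (\<lambda>_. 0)"

definition equilibrium :: "('a::finite \<Rightarrow> 'a \<Rightarrow> real) \<Rightarrow> 'a set \<Rightarrow> 'a set \<Rightarrow> 'a \<Rightarrow> real" where
  "equilibrium p Y Z = dirichlet_solution p (Y \<union> Z) (\<lambda>_. 0) (indicator Y)"

lemma laplacian_diff: "laplacian p (\<lambda>x. u x - v x) x = laplacian p u x - laplacian p v x"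
  by (simp add: laplacian_def algebra_simps sum_subtractf)

lemma laplacian_add: "laplacian p (\<lambda>x. u x + v x) x = laplacian p u x + laplacian p v x"
  by (simp add: laplacian_def algebra_simps sum.distrib)

lemma laplacian_scale: "laplacian p (\<lambda>x. c * u x) x = c * laplacian p u x"
  by (simp add: laplacian_def algebra_simps sum_distrib_left)

section \<open>Irreducible chains: minimum principle and Dirichlet problems\<close>

locale irreducible_chain =
  fixes p :: "'a::finite \<Rightarrow> 'a \<Rightarrow> real"
  assumes nonneg: "0 \<le> p x y"
    and row_sum: "(\<Sum>y\<in>UNIV. p x y) = 1"
    and irreducible: "(x, y) \<in> {(z, w). 0 < p z w}\<^sup>*"
begin

lemma laplacian_const: "laplacian p (\<lambda>_. c) x = 0"
  by (simp add: laplacian_def row_sum flip: sum_distrib_right)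

text \<open>At an interior point where \<open>u\<close> attains a negative minimum, superharmonicity
  makes every neighbour a minimum point too. Irreducibility carries the minimum along positive
  transitions into \<open>D\<close>, against the boundary values.\<close>

lemma minimum_principle:
  assumes D: "D \<noteq> {}" and bd: "\<And>x. x \<in> D \<Longrightarrow> 0 \<le> u x"
    and sup: "\<And>x. x \<notin> D \<Longrightarrow> 0 \<le> laplacian p u x"
  shows "0 \<le> u x"
proof (rule ccontr)
  assume neg: "\<not> 0 \<le> u x"
  define m where "m = Min (range u)"
  have m_le: "m \<le> u y" for y by (simp add: m_def)
  have "m \<in> range u" unfolding m_def by (rule Min_in) auto
  then obtain x1 where x1: "u x1 = m" by auto
  have mneg: "m < 0" using m_le[of x] neg by simp
  obtain d where d: "d \<in> D" using D by blast
  have step: "u w = m" if "u z = m" "0 < p z w" for z w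
  proof -
    have "z \<notin> D" using bd[of z] that mneg by auto
    then have "0 \<le> m - (\<Sum>y\<in>UNIV. p z y * u y)" using sup[of z] that by (simp add: laplacian_def)
    then have "(\<Sum>y\<in>UNIV. p z y * (u y - m)) \<le> 0"
      by (simp add: algebra_simps sum_subtractf row_sum flip: sum_distrib_left)
    moreover have "p z w * (u w - m) \<le> (\<Sum>y\<in>UNIV. p z y * (u y - m))"
      by (rule member_le_sum) (auto simp: nonneg m_le)
    ultimately have "p z w * (u w - m) \<le> 0" by linarith
    then show ?thesis using that m_le[of w] by (simp add: mult_le_0_iff)
  qed
  have "u d = m" using irreducible[of x1 d]
    by (induction rule: rtrancl_induct) (auto simp: x1 step)
  then show False using bd[OF d] mneg by simp
qed

lemma comparison:
  assumes "D \<noteq> {}" "\<And>x. x \<in> D \<Longrightarrow> u x \<le> v x"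
    and "\<And>x. x \<notin> D \<Longrightarrow> laplacian p u x \<le> laplacian p v x"
  shows "u x \<le> v x"
  using minimum_principle[of D "\<lambda>x. v x - u x" x] assms by (simp add: laplacian_diff)

text \<open>The problem is a square linear system: \<open>T\<close> keeps the values on
  \<open>D\<close> and takes the Laplacian elsewhere. Comparison with 0 makes \<open>T\<close>
  injective, hence surjective.\<close>

lemma dirichlet_problem_solvable:
  assumes D: "D \<noteq> {}"
  shows "\<exists>u. (\<forall>x\<in>D. u x = g x) \<and> (\<forall>x. x \<notin> D \<longrightarrow> laplacian p u x = f x)"
proof -
  define T :: "real^'a \<Rightarrow> real^'a" where
    "T v = (\<chi> x. if x \<in> D then v $ x else laplacian p (\<lambda>y. v $ y) x)" for v
  have lin: "linear T"
    by (rule linearI)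
       (simp_all add: T_def vec_eq_iff laplacian_def algebra_simps sum.distrib sum_distrib_left)
  have "inj T"
  proof (subst linear_injective_0[OF lin], intro allI impI)
    fix v assume v: "T v = 0"
    have eq: "(if x \<in> D then v $ x else laplacian p (\<lambda>y. v $ y) x) = 0" for x
      using arg_cong[OF v, of "\<lambda>v. v $ x"] by (simp add: T_def)
    have eqs: "x \<in> D \<Longrightarrow> v $ x = 0" "x \<notin> D \<Longrightarrow> laplacian p (\<lambda>y. v $ y) x = 0" for x
      using eq[of x] by auto
    have "v $ x \<le> 0" "0 \<le> v $ x" for x
      using comparison[of D "\<lambda>y. v $ y" "\<lambda>_. 0" x] comparison[of D "\<lambda>_. 0" "\<lambda>y. v $ y" x] D
      by (simp_all add: eqs laplacian_const)
    then show "v = 0" by (simp add: vec_eq_iff order_antisym)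
  qed
  then have "surj T" using linear_injective_imp_surjective[OF lin] by simp
  then obtain v where "T v = (\<chi> x. if x \<in> D then g x else f x)" by (metis surjD)
  then have "(if x \<in> D then v $ x else laplacian p (\<lambda>y. v $ y) x) = (if x \<in> D then g x else f x)" for x
    by (simp add: T_def vec_eq_iff)
  then show ?thesis by (intro exI[of _ "\<lambda>y. v $ y"]) (metis (full_types))
qed

lemma
  assumes "D \<noteq> {}"
  shows dirichlet_solution_boundary: "x \<in> D \<Longrightarrow> dirichlet_solution p D f g x = g x"
    and dirichlet_solution_interior:
      "x \<notin> D \<Longrightarrow> laplacian p (dirichlet_solution p D f g) x = f x"
  using someI_ex[OF dirichlet_problem_solvable[OF assms, of g f]]
  unfolding dirichlet_solution_def by blast+

lemma
  assumes "D \<noteq> {}"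
  shows mean_hitting_boundary: "x \<in> D \<Longrightarrow> mean_hitting p D x = 0"
    and mean_hitting_interior: "x \<notin> D \<Longrightarrow> laplacian p (mean_hitting p D) x = 1"
  using assms
  by (simp_all add: mean_hitting_def dirichlet_solution_boundary dirichlet_solution_interior)

lemma mean_hitting_nonneg:
  assumes "D \<noteq> {}"
  shows "0 \<le> mean_hitting p D x"
  by (rule minimum_principle[OF assms])
     (simp_all add: assms mean_hitting_boundary mean_hitting_interior)

lemma equilibrium_one: "x \<in> Y \<Longrightarrow> equilibrium p Y Z x = 1"
  unfolding equilibrium_def by (subst dirichlet_solution_boundary) auto

lemma equilibrium_zero: "Y \<inter> Z = {} \<Longrightarrow> x \<in> Z \<Longrightarrow> equilibrium p Y Z x = 0"
  unfolding equilibrium_def by (subst dirichlet_solution_boundary) (auto simp: indicator_def)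

lemma equilibrium_harmonic:
  "Y \<union> Z \<noteq> {} \<Longrightarrow> x \<notin> Y \<Longrightarrow> x \<notin> Z \<Longrightarrow> laplacian p (equilibrium p Y Z) x = 0"
  by (simp add: equilibrium_def dirichlet_solution_interior)

lemma
  assumes disj: "Y \<inter> Z = {}" and ne: "Y \<union> Z \<noteq> {}"
  shows equilibrium_nonneg: "0 \<le> equilibrium p Y Z x"
    and equilibrium_le_one: "equilibrium p Y Z x \<le> 1"
proof -
  have bd: "0 \<le> equilibrium p Y Z y \<and> equilibrium p Y Z y \<le> 1" if "y \<in> Y \<union> Z" for y
    using that disj by (cases "y \<in> Y") (auto simp: equilibrium_one equilibrium_zero)
  show "0 \<le> equilibrium p Y Z x"
    by (rule minimum_principle[OF ne]) (use bd in \<open>auto simp: equilibrium_harmonic[OF ne]\<close>)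
  show "equilibrium p Y Z x \<le> 1"
    by (rule comparison[OF ne, where v = "\<lambda>_. 1"])
       (use bd in \<open>auto simp: equilibrium_harmonic[OF ne] laplacian_const\<close>)
qed

lemma laplacian_equilibrium_nonneg:
  assumes "Y \<inter> Z = {}" "y \<in> Y"
  shows "0 \<le> laplacian p (equilibrium p Y Z) y"
proof -
  have "(\<Sum>z\<in>UNIV. p y z * equilibrium p Y Z z) \<le> (\<Sum>z\<in>UNIV. p y z * 1)"
    using assms by (intro sum_mono mult_left_mono nonneg equilibrium_le_one) auto
  then show ?thesis using assms by (simp add: laplacian_def equilibrium_one row_sum)
qed

text \<open>The potential of \<open>(Y', Z')\<close> is superharmonic off
  \<open>Y \<union> Z\<close>: on \<open>Y'\<close> it has its maximal value 1, and it is harmonic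
  at the remaining points. It also dominates on \<open>Y \<union> Z\<close>, so comparison
  applies.\<close>

lemma equilibrium_mono:
  assumes disj: "Y \<inter> Z = {}" "Y' \<inter> Z' = {}" and ne: "Y \<union> Z \<noteq> {}"
    and Y: "Y \<subseteq> Y'" and Z: "Z' \<subseteq> Z" and ne': "Y' \<union> Z' \<noteq> {}"
  shows "equilibrium p Y Z x \<le> equilibrium p Y' Z' x"
proof (rule comparison[OF ne])
  fix x assume "x \<in> Y \<union> Z"
  then consider "x \<in> Y" | "x \<in> Z" "x \<notin> Y" by blast
  then show "equilibrium p Y Z x \<le> equilibrium p Y' Z' x"
  proof cases
    case 1
    then show ?thesis using Y by (simp add: equilibrium_one subset_iff)
  next
    case 2
    then show ?thesis by (simp add: equilibrium_zero disj equilibrium_nonneg[OF disj(2) ne'])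
  qed
next
  fix x assume x: "x \<notin> Y \<union> Z"
  then have "x \<notin> Z'" using Z by auto
  then have "0 \<le> laplacian p (equilibrium p Y' Z') x"
    by (cases "x \<in> Y'")
      (simp_all add: laplacian_equilibrium_nonneg[OF disj(2)] equilibrium_harmonic[OF ne'])
  then show "laplacian p (equilibrium p Y Z) x \<le> laplacian p (equilibrium p Y' Z') x"
    using x by (simp add: equilibrium_harmonic[OF ne])
qed

text \<open>The next two bounds replace the strong Markov property at the hitting time of \<open>A \<union> Z\<close>.\<close>

lemma mean_hitting_upper:
  assumes Z: "Z \<noteq> {}" and c: "0 \<le> c" "\<And>b. b \<in> A \<Longrightarrow> mean_hitting p Z b \<le> c"
  shows "mean_hitting p Z x \<le> mean_hitting p (A \<union> Z) x + c"
proof (rule comparison[of "A \<union> Z"])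
  have ne: "A \<union> Z \<noteq> {}" using Z by simp
  show "A \<union> Z \<noteq> {}" by fact
  show "mean_hitting p Z x \<le> mean_hitting p (A \<union> Z) x + c" if "x \<in> A \<union> Z" for x
    using that c by (cases "x \<in> Z") (auto simp: mean_hitting_boundary[OF ne] mean_hitting_boundary[OF Z])
  show "laplacian p (mean_hitting p Z) x \<le> laplacian p (\<lambda>x. mean_hitting p (A \<union> Z) x + c) x"
    if "x \<notin> A \<union> Z" for x
    using that by (simp add: laplacian_add laplacian_const mean_hitting_interior[OF ne] mean_hitting_interior[OF Z])
qed

lemma mean_hitting_lower:
  assumes Z: "Z \<noteq> {}" and disj: "Z \<inter> A = {}" and c: "\<And>b. b \<in> A \<Longrightarrow> c \<le> mean_hitting p Z b"
  shows "mean_hitting p (A \<union> Z) x + c * (1 - equilibrium p Z A x) \<le> mean_hitting p Z x"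
proof (rule comparison[of "A \<union> Z"])
  have ne: "A \<union> Z \<noteq> {}" "Z \<union> A \<noteq> {}" using Z by auto
  show "A \<union> Z \<noteq> {}" by fact
  show "mean_hitting p (A \<union> Z) x + c * (1 - equilibrium p Z A x) \<le> mean_hitting p Z x"
    if "x \<in> A \<union> Z" for x
  proof (cases "x \<in> Z")
    case True
    then show ?thesis
      by (simp add: mean_hitting_boundary[OF ne(1)] mean_hitting_boundary[OF Z] equilibrium_one)
  next
    case False
    then show ?thesis using that c
      by (simp add: mean_hitting_boundary[OF ne(1)] equilibrium_zero[OF disj])
  qed
  show "laplacian p (\<lambda>x. mean_hitting p (A \<union> Z) x + c * (1 - equilibrium p Z A x)) x
      \<le> laplacian p (mean_hitting p Z) x" if "x \<notin> A \<union> Z" for x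
    using that
    by (simp add: laplacian_add laplacian_scale laplacian_diff laplacian_const equilibrium_harmonic[OF ne(2)]
        mean_hitting_interior[OF ne(1)] mean_hitting_interior[OF Z])
qed

end

section \<open>Reversible chains: Green's identity, capacities and mean hitting times\<close>

locale reversible_chain = irreducible_chain p
  for p :: "'a::finite \<Rightarrow> 'a \<Rightarrow> real" +
  fixes m :: "'a \<Rightarrow> real"
  assumes weight_nonneg: "0 \<le> m x"
    and reversible: "m x * p x y = m y * p y x"
begin

text \<open>The polarization of the Dirichlet form, which is \<open>energy f f\<close>.\<close>

definition energy :: "('a \<Rightarrow> real) \<Rightarrow> ('a \<Rightarrow> real) \<Rightarrow> real" where
  "energy f g = 1 / 2 * (\<Sum>y\<in>UNIV. \<Sum>z\<in>UNIV. m y * p y z * ((f y - f z) * (g y - g z)))"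

definition capacity :: "'a set \<Rightarrow> 'a set \<Rightarrow> real" where
  "capacity Y Z = (INF f\<in>{f. (\<forall>x. 0 \<le> f x \<and> f x \<le> 1) \<and> (\<forall>y\<in>Y. f y = 1) \<and> (\<forall>z\<in>Z. f z = 0)}.
        energy f f)"

lemma energy_nonneg: "0 \<le> energy f f"
  unfolding energy_def
  by (intro mult_nonneg_nonneg[OF _ sum_nonneg] sum_nonneg mult_nonneg_nonneg[OF _ zero_le_square])
     (simp_all add: weight_nonneg nonneg)

lemma energy_sym: "energy f g = energy g f"
  by (simp add: energy_def mult.commute)

text \<open>Summation by parts: the product of differences splits into a term with
  \<open>g y\<close> and a term with \<open>g z\<close>. Reversibility makes their sums equal after
  exchanging \<open>y\<close> and \<open>z\<close>, which cancels the factor 1/2.\<close>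

lemma green: "energy f g = (\<Sum>y\<in>UNIV. m y * g y * laplacian p f y)"
proof -
  let ?S = "\<lambda>F. (\<Sum>y\<in>UNIV. \<Sum>z\<in>UNIV. m y * p y z * (F y z :: real))"
  have "energy f g = 1 / 2 * (?S (\<lambda>y z. (f y - f z) * g y) + ?S (\<lambda>y z. (f z - f y) * g z))"
    unfolding energy_def sum.distrib[symmetric]
    by (intro arg_cong2[where f = "(*)"] refl sum.cong) (simp add: algebra_simps)
  also have "?S (\<lambda>y z. (f z - f y) * g z) = (\<Sum>y\<in>UNIV. \<Sum>z\<in>UNIV. m z * p z y * ((f y - f z) * g y))"
    by (rule sum.swap)
  also have "\<dots> = ?S (\<lambda>y z. (f y - f z) * g y)"
    by (intro sum.cong refl) (simp add: reversible)
  finally have "energy f g = ?S (\<lambda>y z. (f y - f z) * g y)" by simp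
  also have "\<dots> = (\<Sum>y\<in>UNIV. m y * g y * (\<Sum>z\<in>UNIV. p y z * (f y - f z)))"
    by (simp add: sum_distrib_left algebra_simps)
  also have "\<dots> = (\<Sum>y\<in>UNIV. m y * g y * laplacian p f y)"
    by (simp add: laplacian_def right_diff_distrib sum_subtractf row_sum flip: sum_distrib_right)
  finally show ?thesis .
qed

lemma green_symmetric:
  "(\<Sum>y\<in>UNIV. m y * g y * laplacian p f y) = (\<Sum>y\<in>UNIV. m y * f y * laplacian p g y)"
  using green[of f g] green[of g f] energy_sym[of f g] by simp

lemma energy_add:
  "energy (\<lambda>x. f x + g x) (\<lambda>x. f x + g x) = energy f f + 2 * energy f g + energy g g"
proof -
  have "m y * p y z * ((f y + g y - (f z + g z)) * (f y + g y - (f z + g z))) =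
      m y * p y z * ((f y - f z) * (f y - f z)) + 2 * (m y * p y z * ((f y - f z) * (g y - g z))) +
      m y * p y z * ((g y - g z) * (g y - g z))" for y z
    by algebra
  then show ?thesis
    unfolding energy_def by (simp add: sum.distrib distrib_left flip: sum_distrib_left)
qed

lemma capacity_le:
  assumes "\<And>x. 0 \<le> f x" "\<And>x. f x \<le> 1" "\<And>y. y \<in> Y \<Longrightarrow> f y = 1" "\<And>z. z \<in> Z \<Longrightarrow> f z = 0"
  shows "capacity Y Z \<le> energy f f"
  unfolding capacity_def
  by (rule cINF_lower) (use assms energy_nonneg in \<open>auto intro!: bdd_belowI2[where m = 0]\<close>)

lemma le_capacity:
  assumes "Y \<inter> Z = {}"
    and "\<And>f. (\<And>x. 0 \<le> f x) \<Longrightarrow> (\<And>x. f x \<le> 1) \<Longrightarrow> (\<And>y. y \<in> Y \<Longrightarrow> f y = 1) \<Longrightarrow>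
           (\<And>z. z \<in> Z \<Longrightarrow> f z = 0) \<Longrightarrow> c \<le> energy f f"
  shows "c \<le> capacity Y Z"
  unfolding capacity_def
proof (rule cINF_greatest)
  have "indicator Y \<in> {f. (\<forall>x. 0 \<le> f x \<and> f x \<le> 1) \<and> (\<forall>y\<in>Y. f y = 1) \<and> (\<forall>z\<in>Z. f z = (0::real))}"
    using assms(1) by (auto simp: indicator_def)
  then show "{f. (\<forall>x. 0 \<le> f x \<and> f x \<le> 1) \<and> (\<forall>y\<in>Y. f y = 1) \<and> (\<forall>z\<in>Z. f z = (0::real))} \<noteq> {}"
    by blast
qed (use assms(2) in auto)

lemma capacity_nonneg: "Y \<inter> Z = {} \<Longrightarrow> 0 \<le> capacity Y Z"
  by (rule le_capacity) (auto simp: energy_nonneg)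

lemma capacity_mono:
  assumes "Y \<inter> Z = {}" "Z' \<subseteq> Z"
  shows "capacity Y Z' \<le> capacity Y Z"
  using assms by (intro le_capacity capacity_le) auto

text \<open>Dirichlet principle: the difference of an admissible \<open>f\<close> and the potential
  vanishes on \<open>Y \<union> Z\<close>, and the potential is harmonic elsewhere. So the two are
  orthogonal for \<open>energy\<close>, and the difference can only add energy.\<close>

lemma capacity_eq_energy:
  assumes YZ: "Y \<inter> Z = {}" "Y \<union> Z \<noteq> {}"
  shows "capacity Y Z = energy (equilibrium p Y Z) (equilibrium p Y Z)"
proof (rule order_antisym)
  let ?h = "equilibrium p Y Z"
  show "capacity Y Z \<le> energy ?h ?h"
    by (rule capacity_le)
       (use YZ(1) in \<open>auto simp: equilibrium_one equilibrium_zero equilibrium_nonneg[OF YZ]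
          equilibrium_le_one[OF YZ]\<close>)
  show "energy ?h ?h \<le> capacity Y Z"
  proof (rule le_capacity[OF YZ(1)])
    fix f :: "'a \<Rightarrow> real"
    assume f: "\<And>y. y \<in> Y \<Longrightarrow> f y = 1" "\<And>z. z \<in> Z \<Longrightarrow> f z = 0"
    have "m x * (f x - ?h x) * laplacian p ?h x = 0" for x
    proof (cases "x \<in> Y \<union> Z")
      case True
      then have "f x = ?h x" using f YZ by (auto simp: equilibrium_one equilibrium_zero)
      then show ?thesis by simp
    qed (simp add: equilibrium_harmonic[OF YZ(2)])
    then have "energy ?h (\<lambda>x. f x - ?h x) = 0" unfolding green by (intro sum.neutral ballI)
    then have "energy f f = energy ?h ?h + energy (\<lambda>x. f x - ?h x) (\<lambda>x. f x - ?h x)"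
      using energy_add[of ?h "\<lambda>x. f x - ?h x"] by simp
    then show "energy ?h ?h \<le> energy f f" using energy_nonneg by simp
  qed
qed

text \<open>In Green's identity of the potential with itself only \<open>Y\<close> contributes,
  since the potential is 0 on \<open>Z\<close> and harmonic elsewhere. Capacity is thus the total
  equilibrium charge of \<open>Y\<close>.\<close>

lemma capacity_eq_flux:
  assumes YZ: "Y \<inter> Z = {}" "Y \<union> Z \<noteq> {}"
  shows "capacity Y Z = (\<Sum>y\<in>Y. m y * laplacian p (equilibrium p Y Z) y)"
proof -
  let ?h = "equilibrium p Y Z"
  have "capacity Y Z = (\<Sum>y\<in>UNIV. m y * ?h y * laplacian p ?h y)"
    by (simp add: capacity_eq_energy[OF YZ] green)
  also have "\<dots> = (\<Sum>y\<in>Y. m y * ?h y * laplacian p ?h y)"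
  proof (rule sum.mono_neutral_right)
    show "\<forall>y\<in>UNIV - Y. m y * ?h y * laplacian p ?h y = 0"
    proof
      fix y assume "y \<in> UNIV - Y"
      then show "m y * ?h y * laplacian p ?h y = 0"
        by (cases "y \<in> Z") (simp_all add: YZ(1) equilibrium_harmonic[OF YZ(2)] equilibrium_zero)
    qed
  qed simp_all
  also have "\<dots> = (\<Sum>y\<in>Y. m y * laplacian p ?h y)"
    by (rule sum.cong) (use YZ in \<open>auto simp: equilibrium_one\<close>)
  finally show ?thesis .
qed

text \<open>Green's identity for the potential and the mean hitting time. The latter vanishes on
  \<open>Z\<close> and has Laplacian 1 elsewhere; the potential vanishes on \<open>Z\<close> and has
  its remaining charge on \<open>Y\<close>.\<close>

lemma mean_hitting_flux:
  assumes YZ: "Y \<inter> Z = {}" "Z \<noteq> {}"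
  shows "(\<Sum>y\<in>Y. m y * laplacian p (equilibrium p Y Z) y * mean_hitting p Z y) =
         (\<Sum>y\<in>UNIV. m y * equilibrium p Y Z y)"
proof -
  let ?h = "equilibrium p Y Z" and ?u = "mean_hitting p Z"
  have "(\<Sum>y\<in>Y. m y * laplacian p ?h y * ?u y) = (\<Sum>y\<in>UNIV. m y * ?u y * laplacian p ?h y)"
    by (rule sum.mono_neutral_cong_left)
       (use YZ(2) in \<open>auto simp: mean_hitting_boundary[OF YZ(2)] intro!: equilibrium_harmonic\<close>)
  also have "\<dots> = (\<Sum>y\<in>UNIV. m y * ?h y * laplacian p ?u y)" by (rule green_symmetric)
  also have "\<dots> = (\<Sum>y\<in>UNIV. m y * ?h y)"
  proof (rule sum.cong)
    fix y show "m y * ?h y * laplacian p ?u y = m y * ?h y"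
      using YZ by (cases "y \<in> Z") (auto simp: equilibrium_zero mean_hitting_interior)
  qed simp
  finally show ?thesis .
qed

text \<open>The equilibrium charge on \<open>Y\<close> is nonnegative with total mass
  \<open>capacity Y Z\<close>, so a bound on the mean hitting time over \<open>Y\<close> passes to
  its charge-weighted sum.\<close>

lemma mean_hitting_capacity_le:
  assumes YZ: "Y \<inter> Z = {}" "Z \<noteq> {}" and "\<And>y. y \<in> Y \<Longrightarrow> mean_hitting p Z y \<le> c"
  shows "(\<Sum>y\<in>UNIV. m y * equilibrium p Y Z y) \<le> c * capacity Y Z"
proof -
  have ne: "Y \<union> Z \<noteq> {}" using YZ by blast
  show ?thesis
    unfolding mean_hitting_flux[OF YZ, symmetric] capacity_eq_flux[OF YZ(1) ne] sum_distrib_left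
    by (intro sum_mono, subst (3) mult.commute, intro mult_left_mono mult_nonneg_nonneg)
       (use assms in \<open>auto simp: weight_nonneg laplacian_equilibrium_nonneg\<close>)
qed

lemma mean_hitting_capacity_ge:
  assumes YZ: "Y \<inter> Z = {}" "Z \<noteq> {}" and "\<And>y. y \<in> Y \<Longrightarrow> c \<le> mean_hitting p Z y"
  shows "c * capacity Y Z \<le> (\<Sum>y\<in>UNIV. m y * equilibrium p Y Z y)"
proof -
  have ne: "Y \<union> Z \<noteq> {}" using YZ by blast
  show ?thesis
    unfolding mean_hitting_flux[OF YZ, symmetric] capacity_eq_flux[OF YZ(1) ne] sum_distrib_left
    by (intro sum_mono, subst (1) mult.commute, intro mult_left_mono mult_nonneg_nonneg)
       (use assms in \<open>auto simp: weight_nonneg laplacian_equilibrium_nonneg\<close>)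
qed

lemma mean_hitting_singleton:
  assumes "x \<notin> Z" "Z \<noteq> {}"
  shows "mean_hitting p Z x * capacity {x} Z = (\<Sum>y\<in>UNIV. m y * equilibrium p {x} Z y)"
  using mean_hitting_capacity_le[of "{x}" Z "mean_hitting p Z x"]
    mean_hitting_capacity_ge[of "{x}" Z "mean_hitting p Z x"] assms by simp

text \<open>Pair the equilibrium potentials \<open>f\<close> of \<open>(Y, Z)\<close> and \<open>g\<close> of \<open>({y}, Y \<union> Z)\<close> in Green's identity:
  as \<open>f\<close> is harmonic wherever \<open>g\<close> does not vanish, \<open>f y\<close> times the flux of \<open>g\<close> out of \<open>y\<close> is its flux
  into \<open>Y\<close>.\<close>

lemma equilibrium_le_capacity_quotient:
  assumes y: "y \<notin> Y" "y \<notin> Z" and YZ: "Y \<inter> Z = {}" and ne: "Y \<noteq> {}" "Z \<noteq> {}"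
  shows "equilibrium p Y Z y * capacity {y} Z \<le> capacity {y} Y"
proof -
  define f where "f = equilibrium p Y Z"
  define g where "g = equilibrium p {y} (Y \<union> Z)"
  define g' where "g' = equilibrium p {y} Y"
  \<comment> \<open>For states of \<open>Y\<close>, where \<open>g\<close> and \<open>g'\<close>
    both vanish: the Laplacian there only sees the values at the neighbours.\<close>
  have lap0: "laplacian p v x = - (\<Sum>z\<in>UNIV. p x z * v z)" if "v x = 0" for v x
    using that by (simp add: laplacian_def)
  have "(\<Sum>x\<in>UNIV. m x * g x * laplacian p f x) = 0"
  proof (rule sum.neutral, rule ballI)
    fix x show "m x * g x * laplacian p f x = 0"
    proof (cases "x \<in> Y \<union> Z")
      case True
      then have "g x = 0" using y by (auto simp: g_def equilibrium_zero)
      then show ?thesis by simp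
    qed (use ne in \<open>simp add: f_def equilibrium_harmonic\<close>)
  qed
  then have "0 = (\<Sum>x\<in>UNIV. m x * f x * laplacian p g x)"
    using green_symmetric[of g f] by simp
  also have "\<dots> = (\<Sum>x\<in>insert y Y. m x * f x * laplacian p g x)"
  proof (rule sum.mono_neutral_right)
    show "\<forall>x\<in>UNIV - insert y Y. m x * f x * laplacian p g x = 0"
    proof
      fix x assume "x \<in> UNIV - insert y Y"
      then show "m x * f x * laplacian p g x = 0"
        by (cases "x \<in> Z") (simp_all add: f_def g_def YZ equilibrium_zero equilibrium_harmonic)
    qed
  qed simp_all
  also have "\<dots> = f y * (m y * laplacian p g y) + (\<Sum>x\<in>Y. m x * laplacian p g x)"
    using y ne by (subst sum.insert) (auto simp: f_def equilibrium_one)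
  also have "m y * laplacian p g y = capacity {y} (Y \<union> Z)"
    using y by (subst capacity_eq_flux) (auto simp: g_def)
  finally have flow: "f y * capacity {y} (Y \<union> Z) = - (\<Sum>x\<in>Y. m x * laplacian p g x)" by simp
  \<comment> \<open>Dropping \<open>Z\<close> from the zero set gives \<open>g \<le> g'\<close>, so
    the flux into \<open>Y\<close> can only grow.\<close>
  have "- (\<Sum>x\<in>Y. m x * laplacian p g x) \<le> - (\<Sum>x\<in>Y. m x * laplacian p g' x)"
  proof (intro le_imp_neg_le sum_mono mult_left_mono weight_nonneg)
    fix x assume x: "x \<in> Y"
    have "g x = 0" "g' x = 0" using x y by (auto simp: g_def g'_def equilibrium_zero)
    then show "laplacian p g' x \<le> laplacian p g x"
      using y by (simp add: lap0) (auto intro!: sum_mono mult_left_mono equilibrium_mono nonneg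
        simp: g_def g'_def)
  qed
  \<comment> \<open>Constants are harmonic, so the total charge of \<open>g'\<close> is 0 and its
    flux into \<open>Y\<close> equals its flux out of \<open>y\<close>.\<close>
  also have "- (\<Sum>x\<in>Y. m x * laplacian p g' x) = m y * laplacian p g' y"
  proof -
    have "0 = (\<Sum>x\<in>UNIV. m x * 1 * laplacian p g' x)"
      using green_symmetric[of "\<lambda>_. 1" g'] by (simp add: laplacian_const)
    also have "\<dots> = (\<Sum>x\<in>insert y Y. m x * 1 * laplacian p g' x)"
      by (rule sum.mono_neutral_right) (auto simp: g'_def equilibrium_harmonic)
    also have "\<dots> = m y * laplacian p g' y + (\<Sum>x\<in>Y. m x * laplacian p g' x)"
      using y by (subst sum.insert) auto
    finally show ?thesis by simp
  qed
  also have "\<dots> = capacity {y} Y"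
    using y by (subst capacity_eq_flux) (auto simp: g'_def)
  finally have "f y * capacity {y} (Y \<union> Z) \<le> capacity {y} Y" by (simp add: flow)
  moreover have "0 \<le> f y" unfolding f_def by (rule equilibrium_nonneg) (use YZ ne in auto)
  then have "f y * capacity {y} Z \<le> f y * capacity {y} (Y \<union> Z)"
    using y by (intro mult_left_mono capacity_mono) auto
  ultimately show ?thesis by (simp add: f_def)
qed

section \<open>Capacity bounds from cuts and from paths\<close>

text \<open>The indicator of \<open>C\<close> is an admissible test function, and its energy is the
  conductance across the boundary of \<open>C\<close>.\<close>

lemma capacity_le_cut:
  assumes "y \<in> C" "C \<inter> Z = {}"
  shows "capacity {y} Z \<le> (\<Sum>z\<in>C. \<Sum>w\<in>- C. m z * p z w)"
proof -
  let ?f = "indicator C :: 'a \<Rightarrow> real"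
  have lap: "laplacian p ?f z = (\<Sum>w\<in>- C. p z w)" if "z \<in> C" for z
  proof -
    have "1 = (\<Sum>w\<in>C \<union> - C. p z w)" by (simp add: row_sum)
    also have "\<dots> = (\<Sum>w\<in>C. p z w) + (\<Sum>w\<in>- C. p z w)" by (rule sum.union_disjoint) auto
    finally show ?thesis using that by (simp add: laplacian_def sum.inter_restrict indicator_def)
  qed
  have "capacity {y} Z \<le> energy ?f ?f"
    by (rule capacity_le) (use assms in \<open>auto simp: indicator_def\<close>)
  also have "\<dots> = (\<Sum>z\<in>C. m z * laplacian p ?f z)"
    unfolding green by (rule sum.mono_neutral_cong_right) (auto simp: indicator_def)
  also have "\<dots> = (\<Sum>z\<in>C. \<Sum>w\<in>- C. m z * p z w)"
    by (rule sum.cong) (simp_all add: lap sum_distrib_left)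
  finally show ?thesis .
qed

text \<open>A test function falls from 1 to 0 along the path. Conductance at least \<open>c\<close>
  bounds its drop over each edge by \<open>\<delta>\<close>, so \<open>n * \<delta>\<close> is at
  least 1. The factor 2 undoes the 1/2 in \<open>energy\<close>.\<close>

lemma capacity_ge_path:
  assumes path: "(y, b) \<in> R ^^ n" and b: "b \<in> Z" and y: "y \<notin> Z"
    and c: "0 < c" "\<And>z w. (z, w) \<in> R \<Longrightarrow> c \<le> m z * p z w"
  shows "c \<le> 2 * (real n)\<^sup>2 * capacity {y} Z"
proof -
  have n: "n \<noteq> 0" using path b y by (cases n) auto
  have "c / (2 * (real n)\<^sup>2) \<le> capacity {y} Z"
  proof (rule le_capacity)
    show "{y} \<inter> Z = {}" using y by simp
    fix f :: "'a \<Rightarrow> real"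
    assume f: "\<And>x. x \<in> {y} \<Longrightarrow> f x = 1" "\<And>z. z \<in> Z \<Longrightarrow> f z = 0"
    define \<delta> where "\<delta> = sqrt (2 * energy f f / c)"
    have edge: "\<bar>f z - f w\<bar> \<le> \<delta>" if "(z, w) \<in> R" for z w
    proof -
      have pos: "0 \<le> m z * p z w * ((f z - f w) * (f z - f w))" for z w
        by (intro mult_nonneg_nonneg[OF _ zero_le_square] mult_nonneg_nonneg weight_nonneg nonneg)
      have "c * (f z - f w)\<^sup>2 \<le> m z * p z w * ((f z - f w) * (f z - f w))"
        unfolding power2_eq_square by (rule mult_right_mono[OF c(2)[OF that]]) simp
      also have "\<dots> \<le> (\<Sum>w\<in>UNIV. m z * p z w * ((f z - f w) * (f z - f w)))"
        by (rule member_le_sum) (simp_all only: pos, simp_all)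
      also have "\<dots> \<le> (\<Sum>z\<in>UNIV. \<Sum>w\<in>UNIV. m z * p z w * ((f z - f w) * (f z - f w)))"
        by (rule member_le_sum) (simp_all only: pos sum_nonneg, simp_all)
      also have "\<dots> = 2 * energy f f" by (simp add: energy_def)
      finally have "(f z - f w)\<^sup>2 \<le> 2 * energy f f / c" using c(1) by (simp add: field_simps)
      then show ?thesis unfolding \<delta>_def by (metis real_sqrt_abs real_sqrt_le_iff)
    qed
    have "\<bar>f y - f b\<bar> \<le> real n * \<delta>" using path
    proof (induction n arbitrary: b)
      case (Suc n)
      then obtain z where "(y, z) \<in> R ^^ n" "(z, b) \<in> R" by auto
      then show ?case using Suc.IH[of z] edge[of z b] by (simp add: algebra_simps)
    qed simp
    then have "1 \<le> real n * \<delta>" using f b by simp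
    then have "1 \<le> (real n * \<delta>)\<^sup>2" by (rule one_le_power)
    also have "\<dots> = (real n)\<^sup>2 * (2 * energy f f / c)"
      using c(1) energy_nonneg[of f] by (simp add: \<delta>_def power_mult_distrib)
    finally show "c / (2 * (real n)\<^sup>2) \<le> energy f f" using c(1) n by (simp add: field_simps)
  qed
  then show ?thesis using n by (simp add: field_simps)
qed

end

subsection \<open>Hitting times\<close>

text \<open>The product form covers every history: for a null history, whose conditional
  probabilities are unconstrained, both sides are 0.\<close>

lemma markov_chain_step:
  assumes "markov_chain_from M X p x"
  shows "\<P>(w in M. (\<forall>i\<le>n. X i w = s i) \<and> X (Suc n) w = y) =
         \<P>(w in M. \<forall>i\<le>n. X i w = s i) * p (s n) y"
proof -
  interpret prob_space M using assms by (simp add: markov_chain_from_def)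
  have [measurable]: "X i \<in> measurable M (count_space UNIV)" for i
    using assms by (simp add: markov_chain_from_def)
  show ?thesis
  proof (cases "\<P>(w in M. \<forall>i\<le>n. X i w = s i) > 0")
    case True
    then have "\<P>(w in M. X (Suc n) w = y \<bar> \<forall>i\<le>n. X i w = s i) = p (s n) y"
      using assms unfolding markov_chain_from_def by blast
    with True show ?thesis unfolding cond_prob_def by (simp add: field_simps conj_commute)
  next
    case False
    then have 0: "\<P>(w in M. \<forall>i\<le>n. X i w = s i) = 0" by (simp add: zero_less_measure_iff)
    have "\<P>(w in M. (\<forall>i\<le>n. X i w = s i) \<and> X (Suc n) w = y) \<le> \<P>(w in M. \<forall>i\<le>n. X i w = s i)"
      by (rule finite_measure_mono) auto
    then show ?thesis using 0 by (simp add: measure_le_0_iff)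
  qed
qed

text \<open>Time 0 is left out, in agreement with \<open>hitting_time\<close>.\<close>

definition avoids :: "(nat \<Rightarrow> 'w \<Rightarrow> 'a) \<Rightarrow> 'a set \<Rightarrow> nat \<Rightarrow> 'w \<Rightarrow> bool" where
  "avoids X A n w \<longleftrightarrow> (\<forall>i\<in>{0<..n}. X i w \<notin> A)"

lemma avoids_Suc: "avoids X A (Suc n) w \<longleftrightarrow> avoids X A n w \<and> X (Suc n) w \<notin> A"
  by (auto simp: avoids_def le_Suc_eq)

lemma hitting_time_greater_iff: "enat n < hitting_time X A w \<longleftrightarrow> avoids X A n w"
proof -
  have "enat n < hitting_time X A w \<longleftrightarrow> \<not> hitting_time X A w < enat (Suc n)"
    by (cases "hitting_time X A w") auto
  also have "\<dots> \<longleftrightarrow> avoids X A n w"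
    by (auto simp: hitting_time_def Inf_less_iff avoids_def less_Suc_eq_le)
  finally show ?thesis .
qed

section \<open>The chain killed on its target set\<close>

locale markov_hitting = irreducible_chain p
  for p :: "'a::finite \<Rightarrow> 'a \<Rightarrow> real" +
  fixes M :: "'w measure" and X :: "nat \<Rightarrow> 'w \<Rightarrow> 'a" and x :: 'a and A :: "'a set"
  assumes markov: "markov_chain_from M X p x"
    and start: "x \<notin> A" and nonempty: "A \<noteq> {}"
begin

sublocale prob_space M
  using markov by (simp add: markov_chain_from_def)

lemma measurable_chain[measurable]: "X i \<in> measurable M (count_space UNIV)"
  using markov by (simp add: markov_chain_from_def)

lemma measurable_avoids[measurable]: "Measurable.pred M (avoids X A n)"
  unfolding avoids_def by measurable

text \<open>The sub-probability law at time \<open>n\<close> of the chain killed on entering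
  \<open>A\<close>. As the start lies outside \<open>A\<close>, it has no mass on \<open>A\<close>
  even at time 0.\<close>

definition killed :: "nat \<Rightarrow> 'a \<Rightarrow> real" where
  "killed n y = \<P>(w in M. avoids X A n w \<and> X n w = y)"

lemma killed_nonneg: "0 \<le> killed n y"
  by (simp add: killed_def)

lemma killed_eq_0: "y \<in> A \<Longrightarrow> killed n y = 0"
proof (cases n)
  case 0
  assume "y \<in> A"
  have "\<P>(w in M. X 0 w = x) = 1" using markov by (simp add: markov_chain_from_def)
  then have "AE w in M. X 0 w = x" by (subst (asm) prob_Collect_eq_1) auto
  then have "AE w in M. \<not> (avoids X A 0 w \<and> X 0 w = y)"
    by (rule AE_mp) (use start \<open>y \<in> A\<close> in auto)
  then show ?thesis unfolding killed_def 0 by (subst prob_Collect_eq_0) auto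
next
  case (Suc k)
  assume "y \<in> A"
  then have "{w \<in> space M. avoids X A n w \<and> X n w = y} = {}"
    by (auto simp: avoids_Suc Suc)
  then show ?thesis unfolding killed_def by (simp only: measure_empty)
qed

lemma killed_0: "killed 0 y = (if y = x then 1 else 0)"
proof -
  have 1: "\<P>(w in M. X 0 w = x) = 1" using markov by (simp add: markov_chain_from_def)
  show ?thesis
  proof (cases "y = x")
    case True
    then show ?thesis using 1 by (simp add: killed_def avoids_def)
  next
    case False
    have "AE w in M. X 0 w = x" using 1 by (subst (asm) prob_Collect_eq_1) auto
    then have "AE w in M. \<not> (avoids X A 0 w \<and> X 0 w = y)"
      by (rule AE_mp) (use False in auto)
    then have "killed 0 y = 0" unfolding killed_def by (subst prob_Collect_eq_0) auto
    then show ?thesis using False by simp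
  qed
qed

text \<open>The Markov property is stated for complete histories, so the event is split over the
  trajectories in \<open>S\<close>, all of which end in \<open>z\<close>.\<close>

lemma killed_step:
  "\<P>(w in M. (avoids X A n w \<and> X n w = z) \<and> X (Suc n) w = y) = killed n z * p z y"
proof -
  \<comment> \<open>Extensional functions represent each history exactly once, which makes
    \<open>S\<close> finite and the events disjoint.\<close>
  define S where "S = {s \<in> {..n} \<rightarrow>\<^sub>E (UNIV :: 'a set). s n = z \<and> (\<forall>i\<in>{0<..n}. s i \<notin> A)}"
  have fin: "finite S" unfolding S_def
    by (rule finite_subset[OF _ finite_PiE[of "{..n}" "\<lambda>_. UNIV"]]) (blast, simp_all)
  have split: "\<P>(w in M. (avoids X A n w \<and> X n w = z) \<and> K w) =
      (\<Sum>s\<in>S. \<P>(w in M. (\<forall>i\<le>n. X i w = s i) \<and> K w))"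
    if [measurable]: "Measurable.pred M K" for K
  proof -
    have "{w \<in> space M. (avoids X A n w \<and> X n w = z) \<and> K w} =
        (\<Union>s\<in>S. {w \<in> space M. (\<forall>i\<le>n. X i w = s i) \<and> K w})" (is "?L = ?R")
    proof
      show "?L \<subseteq> ?R"
      proof
        fix w assume w: "w \<in> ?L"
        have "restrict (\<lambda>i. X i w) {..n} \<in> S" using w by (auto simp: S_def avoids_def)
        then show "w \<in> ?R" using w by (intro UN_I) auto
      qed
      show "?R \<subseteq> ?L" by (auto simp: S_def avoids_def)
    qed
    moreover have "disjoint_family_on (\<lambda>s. {w \<in> space M. (\<forall>i\<le>n. X i w = s i) \<and> K w}) S"
    proof (unfold disjoint_family_on_def, intro ballI impI)
      fix s t assume "s \<in> S" "t \<in> S" "s \<noteq> t"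
      moreover have "s = t" if "\<And>i. i \<in> {..n} \<Longrightarrow> s i = t i"
        using calculation that unfolding S_def by (blast intro: PiE_ext)
      ultimately obtain i where "i \<le> n" "s i \<noteq> t i" by auto
      then show "{w \<in> space M. (\<forall>i\<le>n. X i w = s i) \<and> K w} \<inter>
          {w \<in> space M. (\<forall>i\<le>n. X i w = t i) \<and> K w} = {}" by force
    qed
    ultimately show ?thesis using fin by (subst finite_measure_finite_Union[symmetric]) auto
  qed
  have "\<P>(w in M. (avoids X A n w \<and> X n w = z) \<and> X (Suc n) w = y) =
      (\<Sum>s\<in>S. \<P>(w in M. \<forall>i\<le>n. X i w = s i) * p (s n) y)"
    by (subst split) (auto simp: markov_chain_step[OF markov])
  also have "\<dots> = (\<Sum>s\<in>S. \<P>(w in M. \<forall>i\<le>n. X i w = s i)) * p z y"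
    by (auto simp: S_def sum_distrib_right)
  also have "(\<Sum>s\<in>S. \<P>(w in M. \<forall>i\<le>n. X i w = s i)) = killed n z"
    using split[of "\<lambda>_. True"] by (simp add: killed_def)
  finally show ?thesis .
qed

lemma avoids_next: "\<P>(w in M. avoids X A n w \<and> X (Suc n) w = y) = (\<Sum>z\<in>UNIV. killed n z * p z y)"
proof -
  have "{w \<in> space M. avoids X A n w \<and> X (Suc n) w = y} =
      (\<Union>z. {w \<in> space M. (avoids X A n w \<and> X n w = z) \<and> X (Suc n) w = y})" by auto
  then show ?thesis
    unfolding killed_step[symmetric]
    by (simp, subst finite_measure_finite_Union) (auto simp: disjoint_family_on_def)
qed

lemma killed_Suc:
  assumes "y \<notin> A"
  shows "killed (Suc n) y = (\<Sum>z\<in>UNIV. killed n z * p z y)"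
proof -
  have "{w \<in> space M. avoids X A (Suc n) w \<and> X (Suc n) w = y} =
      {w \<in> space M. avoids X A n w \<and> X (Suc n) w = y}"
    using assms by (auto simp: avoids_Suc)
  then have "killed (Suc n) y = \<P>(w in M. avoids X A n w \<and> X (Suc n) w = y)"
    by (simp only: killed_def)
  then show ?thesis by (simp only: avoids_next)
qed

definition survival :: "nat \<Rightarrow> real" where
  "survival n = \<P>(w in M. avoids X A n w)"

lemma survival_eq: "survival n = (\<Sum>y\<in>UNIV. killed n y)"
proof -
  have "{w \<in> space M. avoids X A n w} = (\<Union>y. {w \<in> space M. avoids X A n w \<and> X n w = y})" by auto
  then show ?thesis
    unfolding killed_def survival_def
    by (simp, subst finite_measure_finite_Union) (auto simp: disjoint_family_on_def)
qed

text \<open>Discrete Dynkin formula. The second inner sum is the mass that enters \<open>A\<close>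
  at time \<open>Suc k\<close>, weighted by \<open>v\<close>; each induction step splits the
  one-step law into this lost part and the part kept off \<open>A\<close>.\<close>

lemma killed_dynkin:
  "(\<Sum>y\<in>UNIV. killed n y * v y) =
   v x - (\<Sum>k<n. (\<Sum>y\<in>UNIV. killed k y * laplacian p v y) + (\<Sum>y\<in>A. (\<Sum>z\<in>UNIV. killed k z * p z y) * v y))"
proof (induction n)
  case 0
  show ?case by (simp add: killed_0 if_distrib[of "\<lambda>c. c * _"] cong: if_cong)
next
  case (Suc n)
  have "(\<Sum>y\<in>UNIV. killed n y * v y) - (\<Sum>y\<in>UNIV. killed n y * laplacian p v y) =
      (\<Sum>z\<in>UNIV. \<Sum>y\<in>UNIV. killed n z * p z y * v y)"
    by (simp add: laplacian_def sum_subtractf[symmetric] right_diff_distrib sum_distrib_left mult.assoc)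
  also have "\<dots> = (\<Sum>y\<in>UNIV. (\<Sum>z\<in>UNIV. killed n z * p z y) * v y)"
    by (subst sum.swap) (simp add: sum_distrib_right)
  also have "\<dots> = (\<Sum>y\<in>A \<union> - A. (\<Sum>z\<in>UNIV. killed n z * p z y) * v y)" by simp
  also have "\<dots> = (\<Sum>y\<in>A. (\<Sum>z\<in>UNIV. killed n z * p z y) * v y) +
      (\<Sum>y\<in>- A. (\<Sum>z\<in>UNIV. killed n z * p z y) * v y)"
    by (rule sum.union_disjoint) auto
  also have "(\<Sum>y\<in>- A. (\<Sum>z\<in>UNIV. killed n z * p z y) * v y) = (\<Sum>y\<in>UNIV. killed (Suc n) y * v y)"
    by (rule sum.mono_neutral_cong_left) (auto simp: killed_Suc killed_eq_0)
  finally show ?case using Suc by simp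
qed

text \<open>Dynkin's formula for the mean hitting time: its Laplacian 1 off \<open>A\<close>
  produces the survival probabilities, and its zero values on \<open>A\<close> remove the entrance
  term.\<close>

lemma survival_partial_sums:
  "(\<Sum>k<n. survival k) + (\<Sum>y\<in>UNIV. killed n y * mean_hitting p A y) = mean_hitting p A x"
proof -
  have "(\<Sum>y\<in>UNIV. killed k y * laplacian p (mean_hitting p A) y) = survival k" for k
    unfolding survival_eq
  proof (rule sum.cong)
    fix y show "killed k y * laplacian p (mean_hitting p A) y = killed k y"
      by (cases "y \<in> A") (simp_all add: mean_hitting_interior[OF nonempty] killed_eq_0)
  qed simp
  then show ?thesis
    using killed_dynkin[of n "mean_hitting p A"] by (simp add: mean_hitting_boundary[OF nonempty])
qed

text \<open>The partial sums are bounded by the mean hitting time, so the survival probabilities are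
  summable and tend to 0. The remainder is at most \<open>survival n * C\<close> and vanishes as
  well.\<close>

lemma survival_sums: "survival sums mean_hitting p A x"
proof -
  define u where "u = mean_hitting p A"
  define C where "C = (\<Sum>y\<in>UNIV. u y)"
  have u: "0 \<le> u y" for y unfolding u_def by (rule mean_hitting_nonneg[OF nonempty])
  have uC: "u y \<le> C" for y unfolding C_def by (rule member_le_sum) (auto simp: u)
  have rem: "0 \<le> (\<Sum>y\<in>UNIV. killed n y * u y)" "(\<Sum>y\<in>UNIV. killed n y * u y) \<le> survival n * C" for n
    unfolding survival_eq sum_distrib_right
    by (auto intro!: sum_nonneg sum_mono mult_left_mono uC simp: killed_nonneg u)
  have "summable survival"
  proof (rule bounded_imp_summable)
    show "0 \<le> survival n" for n by (simp add: survival_def)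
    show "sum survival {..n} \<le> u x" for n
      using survival_partial_sums[of "Suc n"] rem(1)[of "Suc n"]
      by (simp add: u_def lessThan_Suc_atMost)
  qed
  then have "survival \<longlonglongrightarrow> 0" by (rule summable_LIMSEQ_zero)
  then have "(\<lambda>n. survival n * C) \<longlonglongrightarrow> 0" by (auto intro: tendsto_mult_left_zero)
  then have "(\<lambda>n. \<Sum>y\<in>UNIV. killed n y * u y) \<longlonglongrightarrow> 0"
    by (rule tendsto_sandwich[OF _ _ tendsto_const, rotated 2]) (use rem in auto)
  then have "(\<lambda>n. u x - (\<Sum>y\<in>UNIV. killed n y * u y)) \<longlonglongrightarrow> u x - 0" by (intro tendsto_intros)
  moreover have "u x - (\<Sum>y\<in>UNIV. killed n y * u y) = (\<Sum>k<n. survival k)" for n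
    using survival_partial_sums[of n] by (simp add: u_def)
  ultimately show ?thesis by (simp add: sums_def u_def)
qed

lemma measurable_hitting_time: "hitting_time X A \<in> measurable M (count_space UNIV)"
proof (subst measurable_count_space_eq2_countable, safe)
  show "hitting_time X A -` {t} \<inter> space M \<in> sets M" for t
  proof (cases t)
    case (enat n)
    have "hitting_time X A -` {t} \<inter> space M =
        {w \<in> space M. \<not> avoids X A n w \<and> (\<forall>k<n. avoids X A k w)}" (is "?L = ?R")
    proof -
      have "hitting_time X A w = enat n \<longleftrightarrow>
          \<not> enat n < hitting_time X A w \<and> (\<forall>k<n. enat k < hitting_time X A w)" for w
      proof (cases "hitting_time X A w")
        case (enat m)
        then show ?thesis by simp (metis linorder_neqE_nat order.irrefl)
      qed simp
      then show ?thesis by (auto simp: hitting_time_greater_iff enat)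
    qed
    then show ?thesis by simp
  next
    case infinity
    have "hitting_time X A w = \<infinity> \<longleftrightarrow> (\<forall>k. enat k < hitting_time X A w)" for w
      by (cases "hitting_time X A w") auto
    then have "hitting_time X A -` {t} \<inter> space M = {w \<in> space M. \<forall>k. avoids X A k w}"
      by (auto simp: hitting_time_greater_iff infinity)
    then show ?thesis by simp
  qed
qed auto

text \<open>The expectation is the sum of the tail probabilities, and these are the survival
  probabilities. This identifies the solution of the Dirichlet problem with the probabilistic
  mean.\<close>

lemma expected_hitting_time_eq: "expected_hitting_time M X A = ennreal (mean_hitting p A x)"
proof -
  have "expected_hitting_time M X A = (\<Sum>t. emeasure M {w \<in> space M. enat t < hitting_time X A w})"
    unfolding expected_hitting_time_def by (rule nn_integral_enat_function[OF measurable_hitting_time])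
  also have "\<dots> = (\<Sum>t. ennreal (survival t))"
    by (simp add: hitting_time_greater_iff survival_def emeasure_eq_measure)
  also have "\<dots> = ennreal (mean_hitting p A x)"
    by (rule suminf_ennreal_eq[OF _ survival_sums]) (simp add: survival_def)
  finally show ?thesis .
qed

end

text \<open>By Dynkin's formula the potential at \<open>x\<close> is, up to the survival
  probability, the probability of entering \<open>insert b A\<close> at \<open>b\<close>. On that
  event \<open>b\<close> is hit before every state of \<open>A\<close>, in particular before
  \<open>a\<close>.\<close>

lemma equilibrium_le_hitting_prob:
  assumes "irreducible_chain p" "markov_chain_from M X p x"
    and "x \<noteq> b" "x \<notin> A" "b \<notin> A" "a \<in> A"
  shows "equilibrium p {b} A x \<le> \<P>(w in M. hitting_time X {b} w < hitting_time X {a} w)"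
proof -
  interpret markov_hitting p M X x "insert b A"
    using assms by (simp add: markov_hitting_def markov_hitting_axioms_def)
  \<comment> \<open>These two interpretations supply the measurability of \<open>avoids\<close> for
    \<open>{a}\<close> and for \<open>{b}\<close>.\<close>
  interpret A: markov_hitting p M X x "{a}"
    using assms by (auto simp add: markov_hitting_def markov_hitting_axioms_def)
  interpret B: markov_hitting p M X x "{b}"
    using assms by (auto simp add: markov_hitting_def markov_hitting_axioms_def)
  let ?h = "equilibrium p {b} A"
  let ?E = "{w \<in> space M. hitting_time X {b} w < hitting_time X {a} w}"
  \<comment> \<open>The first entrance into \<open>insert b A\<close> takes place at time
    \<open>Suc k\<close> and in \<open>b\<close>.\<close>
  define F where "F k = {w \<in> space M. avoids X (insert b A) k w \<and> X (Suc k) w = b}" for k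
  have F[measurable]: "F k \<in> sets M" for k unfolding F_def by measurable
  have E: "?E \<in> sets M"
  proof -
    \<comment> \<open>A strict inequality in \<open>enat\<close> is witnessed by a finite time,
      which writes the event as a countable union.\<close>
    have *: "u < v \<longleftrightarrow> (\<exists>n. \<not> enat n < u \<and> enat n < v)" for u v :: enat
    proof
      assume "u < v"
      moreover from this obtain n where "u = enat n" by (cases u) auto
      ultimately show "\<exists>n. \<not> enat n < u \<and> enat n < v" by auto
    qed (meson not_less order.strict_trans1)
    have "hitting_time X {b} w < hitting_time X {a} w \<longleftrightarrow>
        (\<exists>n. \<not> avoids X {b} n w \<and> avoids X {a} n w)" for w
      using *[of "hitting_time X {b} w" "hitting_time X {a} w"] unfolding hitting_time_greater_iff .
    then show ?thesis by simp
  qed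
  have disj: "disjoint_family F"
  proof (unfold disjoint_family_on_def, safe)
    have *: "F i \<inter> F j = {}" if "i < j" for i j
      using that by (auto simp: F_def avoids_def)
    fix i j w assume "i \<noteq> j" "w \<in> F i" "w \<in> F j"
    then show "w \<in> {}" using *[of i j] *[of j i] by (cases i j rule: linorder_cases) auto
  qed
  have sub: "F k \<subseteq> ?E" for k
  proof
    fix w assume w: "w \<in> F k"
    have "\<not> avoids X {b} (Suc k) w" "avoids X {a} (Suc k) w"
      using w assms by (auto simp: F_def avoids_def le_Suc_eq)
    then show "w \<in> ?E"
      using w unfolding hitting_time_greater_iff[symmetric] F_def by auto
  qed
  have bound: "?h x \<le> prob ?E + survival n" for n
  proof -
    have lap: "killed k y * laplacian p ?h y = 0" for k y
    proof (cases "y \<in> insert b A")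
      case True
      then show ?thesis by (simp add: killed_eq_0)
    qed (simp add: equilibrium_harmonic)
    have bd: "(\<Sum>y\<in>insert b A. c y * ?h y) = c b" for c :: "'a \<Rightarrow> real"
      using \<open>b \<notin> A\<close> by (simp add: equilibrium_one equilibrium_zero)
    have "?h x = (\<Sum>k<n. prob (F k)) + (\<Sum>y\<in>UNIV. killed n y * ?h y)"
      using killed_dynkin[of n ?h] unfolding bd lap F_def avoids_next by simp
    also have "(\<Sum>k<n. prob (F k)) = prob (\<Union>k<n. F k)"
      by (rule finite_measure_finite_Union[symmetric])
         (use disj in \<open>auto simp: disjoint_family_on_def\<close>)
    also have "\<dots> \<le> prob ?E" by (rule finite_measure_mono) (use sub E in auto)
    also have "(\<Sum>y\<in>UNIV. killed n y * ?h y) \<le> survival n"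
      unfolding survival_eq
      by (intro sum_mono mult_left_le killed_nonneg equilibrium_le_one) (use \<open>b \<notin> A\<close> in auto)
    finally show ?thesis by simp
  qed
  have "survival \<longlonglongrightarrow> 0"
    by (rule summable_LIMSEQ_zero[OF sums_summable[OF survival_sums]])
  then have "(\<lambda>n. prob ?E + survival n) \<longlonglongrightarrow> prob ?E + 0" by (intro tendsto_intros)
  then show ?thesis using LIMSEQ_le_const[of _ _ "?h x"] bound by auto
qed

subsection \<open>Logarithmic asymptotics\<close>

text \<open>Exponential decay at rate at least \<open>a\<close>; the slack \<open>\<epsilon>\<close>
  absorbs subexponential factors. The form without logarithms allows \<open>f\<close> to
  vanish.\<close>

definition exp_upper :: "(real \<Rightarrow> real) \<Rightarrow> real \<Rightarrow> bool" where
  "exp_upper f a \<longleftrightarrow> (\<forall>\<epsilon>>0. \<forall>\<^sub>F \<beta> in at_top. f \<beta> \<le> exp (- \<beta> * (a - \<epsilon>)))"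

definition exp_lower :: "(real \<Rightarrow> real) \<Rightarrow> real \<Rightarrow> bool" where
  "exp_lower f a \<longleftrightarrow> (\<forall>\<epsilon>>0. \<forall>\<^sub>F \<beta> in at_top. exp (- \<beta> * (a + \<epsilon>)) \<le> f \<beta>)"

lemma exp_upper_mono:
  assumes "exp_upper g a" "\<forall>\<^sub>F \<beta> in at_top. f \<beta> \<le> g \<beta>" "b \<le> a"
  shows "exp_upper f b"
  unfolding exp_upper_def
proof (intro allI impI)
  fix \<epsilon> :: real assume "\<epsilon> > 0"
  then have "\<forall>\<^sub>F \<beta> in at_top. g \<beta> \<le> exp (- \<beta> * (a - \<epsilon>))" using assms(1) by (simp add: exp_upper_def)
  with assms(2) eventually_gt_at_top[of 0] show "\<forall>\<^sub>F \<beta> in at_top. f \<beta> \<le> exp (- \<beta> * (b - \<epsilon>))"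
  proof eventually_elim
    case (elim \<beta>)
    then have "- \<beta> * (a - \<epsilon>) \<le> - \<beta> * (b - \<epsilon>)" using assms(3) by simp
    then have "exp (- \<beta> * (a - \<epsilon>)) \<le> exp (- \<beta> * (b - \<epsilon>))" by (simp only: exp_le_cancel_iff)
    then show ?case using elim by linarith
  qed
qed

lemma exp_lower_mono:
  assumes "exp_lower g a" "\<forall>\<^sub>F \<beta> in at_top. g \<beta> \<le> f \<beta>"
  shows "exp_lower f a"
  unfolding exp_lower_def
proof (intro allI impI)
  fix \<epsilon> :: real assume "\<epsilon> > 0"
  then have "\<forall>\<^sub>F \<beta> in at_top. exp (- \<beta> * (a + \<epsilon>)) \<le> g \<beta>" using assms(1) by (simp add: exp_lower_def)
  with assms(2) show "\<forall>\<^sub>F \<beta> in at_top. exp (- \<beta> * (a + \<epsilon>)) \<le> f \<beta>"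
    by eventually_elim simp
qed

lemma exp_upper_mult:
  assumes f: "exp_upper f a" "\<forall>\<^sub>F \<beta> in at_top. 0 \<le> f \<beta>"
    and g: "exp_upper g b" "\<forall>\<^sub>F \<beta> in at_top. 0 \<le> g \<beta>"
  shows "exp_upper (\<lambda>\<beta>. f \<beta> * g \<beta>) (a + b)"
  unfolding exp_upper_def
proof (intro allI impI)
  fix \<epsilon> :: real assume "\<epsilon> > 0"
  then have "\<forall>\<^sub>F \<beta> in at_top. f \<beta> \<le> exp (- \<beta> * (a - \<epsilon> / 2))"
    "\<forall>\<^sub>F \<beta> in at_top. g \<beta> \<le> exp (- \<beta> * (b - \<epsilon> / 2))"
    using f(1) g(1) by (auto simp: exp_upper_def)
  with f(2) g(2) show "\<forall>\<^sub>F \<beta> in at_top. f \<beta> * g \<beta> \<le> exp (- \<beta> * (a + b - \<epsilon>))"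
  proof eventually_elim
    case (elim \<beta>)
    then have "f \<beta> * g \<beta> \<le> exp (- \<beta> * (a - \<epsilon> / 2)) * exp (- \<beta> * (b - \<epsilon> / 2))"
      by (intro mult_mono) auto
    also have "\<dots> = exp (- \<beta> * (a + b - \<epsilon>))" by (simp add: exp_add[symmetric] algebra_simps)
    finally show ?case .
  qed
qed

lemma exp_lower_mult:
  assumes f: "exp_lower f a" and g: "exp_lower g b"
  shows "exp_lower (\<lambda>\<beta>. f \<beta> * g \<beta>) (a + b)"
  unfolding exp_lower_def
proof (intro allI impI)
  fix \<epsilon> :: real assume "\<epsilon> > 0"
  then have "\<forall>\<^sub>F \<beta> in at_top. exp (- \<beta> * (a + \<epsilon> / 2)) \<le> f \<beta>"
    "\<forall>\<^sub>F \<beta> in at_top. exp (- \<beta> * (b + \<epsilon> / 2)) \<le> g \<beta>"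
    using f g by (auto simp: exp_lower_def)
  then show "\<forall>\<^sub>F \<beta> in at_top. exp (- \<beta> * (a + b + \<epsilon>)) \<le> f \<beta> * g \<beta>"
  proof eventually_elim
    case (elim \<beta>)
    have "exp (- \<beta> * (a + b + \<epsilon>)) = exp (- \<beta> * (a + \<epsilon> / 2)) * exp (- \<beta> * (b + \<epsilon> / 2))"
      by (simp add: exp_add[symmetric] algebra_simps)
    also have "\<dots> \<le> f \<beta> * g \<beta>"
      using elim by (intro mult_mono) (auto intro: order_trans[OF exp_ge_zero])
    finally show ?case .
  qed
qed

lemma exp_upper_inverse:
  assumes "exp_lower f a"
  shows "exp_upper (\<lambda>\<beta>. inverse (f \<beta>)) (- a)"
  unfolding exp_upper_def
proof (intro allI impI)
  fix \<epsilon> :: real assume "\<epsilon> > 0"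
  then have "\<forall>\<^sub>F \<beta> in at_top. exp (- \<beta> * (a + \<epsilon>)) \<le> f \<beta>" using assms by (simp add: exp_lower_def)
  then show "\<forall>\<^sub>F \<beta> in at_top. inverse (f \<beta>) \<le> exp (- \<beta> * (- a - \<epsilon>))"
  proof eventually_elim
    case (elim \<beta>)
    then have "inverse (f \<beta>) \<le> inverse (exp (- \<beta> * (a + \<epsilon>)))" by (intro le_imp_inverse_le) auto
    also have "\<dots> = exp (- \<beta> * (- a - \<epsilon>))" by (simp add: exp_minus[symmetric] algebra_simps)
    finally show ?case .
  qed
qed

lemma exp_lower_inverse:
  assumes "exp_upper f a" "\<forall>\<^sub>F \<beta> in at_top. 0 < f \<beta>"
  shows "exp_lower (\<lambda>\<beta>. inverse (f \<beta>)) (- a)"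
  unfolding exp_lower_def
proof (intro allI impI)
  fix \<epsilon> :: real assume "\<epsilon> > 0"
  then have "\<forall>\<^sub>F \<beta> in at_top. f \<beta> \<le> exp (- \<beta> * (a - \<epsilon>))" using assms by (simp add: exp_upper_def)
  with assms(2) show "\<forall>\<^sub>F \<beta> in at_top. exp (- \<beta> * (- a + \<epsilon>)) \<le> inverse (f \<beta>)"
  proof eventually_elim
    case (elim \<beta>)
    have "exp (- \<beta> * (- a + \<epsilon>)) = inverse (exp (- \<beta> * (a - \<epsilon>)))"
      by (simp add: exp_minus[symmetric] algebra_simps)
    also have "\<dots> \<le> inverse (f \<beta>)" using elim by (intro le_imp_inverse_le) auto
    finally show ?case .
  qed
qed

text \<open>A constant is eventually below \<open>exp (\<beta> * (\<epsilon> / 2))\<close>, so half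
  of the slack pays for it and the other half for \<open>f\<close>.\<close>

lemma exp_upper_cmult:
  assumes "exp_upper f a" "\<forall>\<^sub>F \<beta> in at_top. 0 \<le> f \<beta>"
  shows "exp_upper (\<lambda>\<beta>. c * f \<beta>) a"
  unfolding exp_upper_def
proof (intro allI impI)
  fix \<epsilon> :: real assume \<epsilon>: "\<epsilon> > 0"
  then have 1: "\<forall>\<^sub>F \<beta> in at_top. f \<beta> \<le> exp (- \<beta> * (a - \<epsilon> / 2))" using assms by (auto simp: exp_upper_def)
  have "filterlim (\<lambda>\<beta>::real. exp (\<beta> * (\<epsilon> / 2))) at_top at_top"
    by (intro filterlim_compose[OF exp_at_top] filterlim_at_top_mult_tendsto_pos[OF tendsto_const])
       (use \<epsilon> in \<open>auto simp: filterlim_ident\<close>)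
  then have 2: "\<forall>\<^sub>F \<beta> in at_top. c \<le> exp (\<beta> * (\<epsilon> / 2))" by (simp add: filterlim_at_top)
  from 1 2 assms(2) show "\<forall>\<^sub>F \<beta> in at_top. c * f \<beta> \<le> exp (- \<beta> * (a - \<epsilon>))"
  proof eventually_elim
    case (elim \<beta>)
    have "c * f \<beta> \<le> exp (\<beta> * (\<epsilon> / 2)) * exp (- \<beta> * (a - \<epsilon> / 2))"
      using elim by (intro mult_mono) auto
    also have "\<dots> = exp (- \<beta> * (a - \<epsilon>))" by (simp add: exp_add[symmetric] algebra_simps)
    finally show ?case .
  qed
qed

text \<open>The sum is at most twice the maximum, and the factor 2 does not change the rate.\<close>

lemma exp_upper_add:
  assumes f: "exp_upper f a" "\<forall>\<^sub>F \<beta> in at_top. 0 \<le> f \<beta>"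
    and g: "exp_upper g a" "\<forall>\<^sub>F \<beta> in at_top. 0 \<le> g \<beta>"
  shows "exp_upper (\<lambda>\<beta>. f \<beta> + g \<beta>) a"
proof -
  have "exp_upper (\<lambda>\<beta>. max (f \<beta>) (g \<beta>)) a"
    using f(1) g(1) by (auto simp: exp_upper_def intro: eventually_conj)
  then have "exp_upper (\<lambda>\<beta>. 2 * max (f \<beta>) (g \<beta>)) a"
    by (rule exp_upper_cmult) (use f(2) in eventually_elim, simp add: le_max_iff_disj)
  then show ?thesis by (rule exp_upper_mono) (auto intro: always_eventually)
qed

lemma exp_upper_zero: "exp_upper (\<lambda>_. 0) a"
  by (simp add: exp_upper_def)

lemma exp_upper_sum:
  assumes "finite A" "\<And>i. i \<in> A \<Longrightarrow> exp_upper (f i) a"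
    and "\<And>i. i \<in> A \<Longrightarrow> \<forall>\<^sub>F \<beta> in at_top. 0 \<le> f i \<beta>"
  shows "exp_upper (\<lambda>\<beta>. \<Sum>i\<in>A. f i \<beta>) a"
  using assms
proof (induction A rule: finite_induct)
  case (insert i A)
  have "\<forall>\<^sub>F \<beta> in at_top. \<forall>i\<in>A. 0 \<le> f i \<beta>" using insert by (simp add: eventually_ball_finite)
  then have "\<forall>\<^sub>F \<beta> in at_top. 0 \<le> (\<Sum>i\<in>A. f i \<beta>)" by eventually_elim (simp add: sum_nonneg)
  then show ?case using insert by (simp add: exp_upper_add)
qed (simp add: exp_upper_zero)

lemma exp_upper_tendsto_0:
  assumes "exp_upper f a" "\<forall>\<^sub>F \<beta> in at_top. 0 \<le> f \<beta>" "0 < a"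
  shows "(f \<longlongrightarrow> 0) at_top"
proof (rule tendsto_sandwich[OF assms(2) _ tendsto_const])
  \<comment> \<open>The slack \<open>a / 2\<close> leaves the positive rate
    \<open>a / 2\<close>.\<close>
  show "\<forall>\<^sub>F \<beta> in at_top. f \<beta> \<le> exp (- \<beta> * (a - a / 2))"
    using assms(1)[unfolded exp_upper_def, rule_format, of "a / 2"] assms(3) by simp
  have "filterlim (\<lambda>\<beta>::real. \<beta> * (a / 2)) at_top at_top"
    by (intro filterlim_at_top_mult_tendsto_pos[OF tendsto_const])
       (use assms in \<open>auto simp: filterlim_ident\<close>)
  then have "((\<lambda>\<beta>. exp (- (\<beta> * (a / 2)))) \<longlongrightarrow> 0) at_top"
    by (intro filterlim_compose[OF exp_at_bot] filterlim_compose[OF filterlim_uminus_at_bot_at_top])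
  then show "((\<lambda>\<beta>. exp (- \<beta> * (a - a / 2))) \<longlongrightarrow> 0) at_top" by simp
qed

lemma
  assumes "(g \<longlongrightarrow> a) at_top"
  shows exp_upper_tendsto: "exp_upper (\<lambda>\<beta>. exp (- \<beta> * g \<beta>)) a"
    and exp_lower_tendsto: "exp_lower (\<lambda>\<beta>. exp (- \<beta> * g \<beta>)) a"
proof -
  have *: "\<forall>\<^sub>F \<beta> in at_top. exp (- \<beta> * g \<beta>) \<le> exp (- \<beta> * (a - \<epsilon>)) \<and>
      exp (- \<beta> * (a + \<epsilon>)) \<le> exp (- \<beta> * g \<beta>)" if "\<epsilon> > 0" for \<epsilon>
  proof -
    have "a - \<epsilon> < a" "a < a + \<epsilon>" using that by auto
    from order_tendstoD(1)[OF assms this(1)] order_tendstoD(2)[OF assms this(2)]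
      eventually_gt_at_top[of "0::real"]
    show ?thesis by eventually_elim auto
  qed
  show "exp_upper (\<lambda>\<beta>. exp (- \<beta> * g \<beta>)) a" "exp_lower (\<lambda>\<beta>. exp (- \<beta> * g \<beta>)) a"
    unfolding exp_upper_def exp_lower_def using * by (simp_all only: eventually_conj_iff) blast+
qed

subsection \<open>The energy landscape\<close>

text \<open>Strictness makes reachability in this relation match strict bounds on communication
  heights, so that paths can be handled by reflexive transitive closures.\<close>

definition below :: "('a \<Rightarrow> real) \<Rightarrow> 'a rate \<Rightarrow> real \<Rightarrow> 'a rel" where
  "below H \<Delta> \<phi> = {(z, w). transition_energy H \<Delta> z w < ereal \<phi>}"

lemma below_mono: "\<phi> \<le> \<psi> \<Longrightarrow> below H \<Delta> \<phi> \<subseteq> below H \<Delta> \<psi>"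
  by (auto simp: below_def intro: order.strict_trans2)

lemma path_height_less_iff:
  assumes "1 < length \<omega>"
  shows "path_height H \<Delta> \<omega> < \<phi> \<longleftrightarrow>
    (\<forall>i. Suc i < length \<omega> \<longrightarrow> transition_energy H \<Delta> (\<omega> ! i) (\<omega> ! Suc i) < \<phi>)"
proof -
  let ?S = "{transition_energy H \<Delta> (\<omega> ! i) (\<omega> ! Suc i) | i. Suc i < length \<omega>}"
  have "finite ?S" by (rule finite_image_set) (auto intro: finite_subset[of _ "{..length \<omega>}"])
  moreover have "?S \<noteq> {}" using assms by auto
  ultimately show ?thesis using assms by (auto simp: path_height_def)
qed

lemma path_imp_rtrancl:
  assumes "path_between x y \<omega>" and steps: "\<And>i. Suc i < length \<omega> \<Longrightarrow> (\<omega> ! i, \<omega> ! Suc i) \<in> R"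
  shows "(x, y) \<in> R\<^sup>*"
proof -
  have ne: "\<omega> \<noteq> []" "hd \<omega> = x" "last \<omega> = y" using assms(1) by (auto simp: path_between_def)
  have "(x, \<omega> ! i) \<in> R\<^sup>*" if "i < length \<omega>" for i
    using that
  proof (induction i)
    case (Suc i)
    then show ?case using steps[of i] by (auto intro: rtrancl_into_rtrancl)
  qed (use ne in \<open>simp add: hd_conv_nth\<close>)
  from this[of "length \<omega> - 1"] show ?thesis using ne by (simp add: last_conv_nth)
qed

text \<open>Distinct endpoints exclude the one-element path: its height is \<open>H x\<close>,
  whereas the reflexive closure accepts it at every level.\<close>

lemma comm_height_less_iff:
  assumes "x \<noteq> y"
  shows "comm_height H \<Delta> x y < ereal \<phi> \<longleftrightarrow> (x, y) \<in> (below H \<Delta> \<phi>)\<^sup>*"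
proof
  assume "comm_height H \<Delta> x y < ereal \<phi>"
  then obtain \<omega> where \<omega>: "path_between x y \<omega>" "path_height H \<Delta> \<omega> < ereal \<phi>"
    by (auto simp: comm_height_def INF_less_iff)
  have len: "1 < length \<omega>"
    using \<omega>(1) assms by (cases \<omega>; cases "tl \<omega>") (auto simp: path_between_def)
  show "(x, y) \<in> (below H \<Delta> \<phi>)\<^sup>*"
    by (rule path_imp_rtrancl[OF \<omega>(1)])
       (use \<omega>(2) in \<open>auto simp: below_def path_height_less_iff[OF len]\<close>)
next
  assume "(x, y) \<in> (below H \<Delta> \<phi>)\<^sup>*"
  then have "\<exists>\<omega>. path_between x y \<omega> \<and> (\<forall>i. Suc i < length \<omega> \<longrightarrow> (\<omega> ! i, \<omega> ! Suc i) \<in> below H \<Delta> \<phi>)"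
  proof (induction rule: rtrancl_induct)
    case base
    show ?case by (rule exI[of _ "[x]"]) (simp add: path_between_def)
  next
    case (step y z)
    then obtain \<omega> where \<omega>: "path_between x y \<omega>"
      "\<forall>i. Suc i < length \<omega> \<longrightarrow> (\<omega> ! i, \<omega> ! Suc i) \<in> below H \<Delta> \<phi>" by blast
    have ne: "\<omega> \<noteq> []" "hd \<omega> = x" "last \<omega> = y" using \<omega>(1) by (auto simp: path_between_def)
    have "((\<omega> @ [z]) ! i, (\<omega> @ [z]) ! Suc i) \<in> below H \<Delta> \<phi>" if "Suc i < length (\<omega> @ [z])" for i
    proof (cases "Suc i < length \<omega>")
      case True
      then show ?thesis using \<omega>(2) by (simp add: nth_append)
    next
      case False
      then have "i = length \<omega> - 1" "Suc i = length \<omega>" using that by auto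
      then show ?thesis using step.hyps(2) ne by (simp add: nth_append last_conv_nth)
    qed
    moreover have "path_between x z (\<omega> @ [z])" using ne by (simp add: path_between_def)
    ultimately show ?case by blast
  qed
  then obtain \<omega> where \<omega>: "path_between x y \<omega>"
    "\<And>i. Suc i < length \<omega> \<Longrightarrow> (\<omega> ! i, \<omega> ! Suc i) \<in> below H \<Delta> \<phi>" by blast
  have "1 < length \<omega>" using \<omega>(1) assms by (cases \<omega>; cases "tl \<omega>") (auto simp: path_between_def)
  then have "path_height H \<Delta> \<omega> < ereal \<phi>" using \<omega>(2) by (auto simp: path_height_less_iff below_def)
  then show "comm_height H \<Delta> x y < ereal \<phi>"
    using \<omega>(1) by (auto simp: comm_height_def INF_less_iff)
qed

text \<open>Translates stability levels into reachability. If no state is lower, the level is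
  \<open>\<infinity>\<close> and both sides are false.\<close>

lemma stability_level_less_iff:
  "stability_level H \<Delta> x < ereal \<gamma> \<longleftrightarrow> (\<exists>y. H y < H x \<and> (x, y) \<in> (below H \<Delta> (H x + \<gamma>))\<^sup>*)"
proof (cases "lower_states H x = {}")
  case True
  then show ?thesis by (auto simp: stability_level_def lower_states_def)
next
  case False
  have "stability_level H \<Delta> x < ereal \<gamma> \<longleftrightarrow>
      (INF y\<in>lower_states H x. comm_height H \<Delta> x y) < ereal (H x + \<gamma>)"
    using False by (simp add: stability_level_def comm_height_sets_def ereal_minus_less add.commute)
  also have "\<dots> \<longleftrightarrow> (\<exists>y. H y < H x \<and> comm_height H \<Delta> x y < ereal (H x + \<gamma>))"
    by (auto simp: INF_less_iff lower_states_def)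
  also have "\<dots> \<longleftrightarrow> (\<exists>y. H y < H x \<and> (x, y) \<in> (below H \<Delta> (H x + \<gamma>))\<^sup>*)"
    by (intro iff_exI conj_cong refl comm_height_less_iff) auto
  finally show ?thesis .
qed

lemma gibbs_nonneg: "0 \<le> gibbs \<beta> g A"
  by (auto simp: gibbs_def intro!: sum_nonneg divide_nonneg_nonneg)

lemma gibbs_pos: "A \<noteq> {} \<Longrightarrow> 0 < gibbs \<beta> g A"
  unfolding gibbs_def by (intro sum_pos divide_pos_pos) auto

lemma gibbs_eq_sum: "gibbs \<beta> g A = (\<Sum>y\<in>A. gibbs \<beta> g {y})"
  by (simp add: gibbs_def)

section \<open>Low-temperature behaviour of the chain, its Gibbs weights and conductances\<close>

context rare_transitions
begin

text \<open>A finite limit rate forces a nonzero transition probability for large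
  \<open>\<beta>\<close>, since \<open>log_rate\<close> would be \<open>\<infinity>\<close>
  otherwise. Finitely many pairs make this uniform, and paths of finite rate give
  reachability.\<close>

lemma irreducible_chain_eventually:
  "\<forall>\<^sub>F \<beta> in at_top. irreducible_chain (P \<beta>)"
proof -
  have "\<forall>\<^sub>F \<beta> in at_top. \<Delta> x y < \<infinity> \<longrightarrow> P \<beta> x y \<noteq> 0" for x y
  proof (cases "\<Delta> x y < \<infinity>")
    case True
    from order_tendstoD(2)[OF rate_limit True] show ?thesis
      by eventually_elim (auto simp: log_rate_def)
  qed simp
  then have "\<forall>\<^sub>F \<beta> in at_top. \<forall>x y. \<Delta> x y < \<infinity> \<longrightarrow> P \<beta> x y \<noteq> 0"
    by (simp add: eventually_all_finite)
  with eventually_gt_at_top[of 0] show ?thesis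
  proof eventually_elim
    case (elim \<beta>)
    have st: "0 \<le> P \<beta> x y" "(\<Sum>y\<in>UNIV. P \<beta> x y) = 1" for x y
      using stochastic[OF elim(1)] by (auto simp: stochastic_matrix_def)
    have pos: "0 < P \<beta> x y" if "\<Delta> x y < \<infinity>" for x y
      using elim(2) that st(1)[of x y] by (metis order_le_less)
    have "(x, y) \<in> {(z, w). 0 < P \<beta> z w}\<^sup>*" for x y
    proof -
      obtain \<omega> where \<omega>: "path_between x y \<omega>"
        "\<And>i. Suc i < length \<omega> \<Longrightarrow> \<Delta> (\<omega> ! i) (\<omega> ! Suc i) < \<infinity>"
        using rate_irreducible unfolding irreducible_rate_def by blast
      then show ?thesis using pos by (intro path_imp_rtrancl[OF \<omega>(1)]) simp
    qed
    then show ?case using st by unfold_locales auto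
  qed
qed

lemma reversible_chain_eventually:
  "\<forall>\<^sub>F \<beta> in at_top. reversible_chain (P \<beta>) (\<lambda>y. gibbs \<beta> (G \<beta>) {y})"
  using irreducible_chain_eventually eventually_gt_at_top[of 0]
proof eventually_elim
  case (elim \<beta>)
  have "exp (- \<beta> * G \<beta> x) * P \<beta> x y = exp (- \<beta> * G \<beta> y) * P \<beta> y x" for x y
    using detailed_balance[OF elim(2), of x y] by (simp add: mult.commute)
  then have "gibbs \<beta> (G \<beta>) {x} * P \<beta> x y = gibbs \<beta> (G \<beta>) {y} * P \<beta> y x" for x y
    by (simp add: gibbs_def)
  moreover have "0 \<le> gibbs \<beta> (G \<beta>) {x}" for x by (auto simp: gibbs_def intro!: divide_nonneg_nonneg sum_nonneg)
  ultimately show ?case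
    using elim(1) by (simp add: reversible_chain_def reversible_chain_axioms_def)
qed

text \<open>Detailed balance in logarithmic form is a symmetric identity at each positive
  \<open>\<beta>\<close> and passes to the limit. Zero transition probabilities occur in both
  directions at once, which settles the infinite values of \<open>log_rate\<close>.\<close>

lemma transition_energy_sym: "transition_energy H \<Delta> x y = transition_energy H \<Delta> y x"
proof -
  have lim: "((\<lambda>\<beta>. ereal (G \<beta> x) + log_rate \<beta> (P \<beta> x y)) \<longlongrightarrow> ereal (H x) + \<Delta> x y) at_top" for x y
    by (rule tendsto_add_ereal_general[OF _ tendsto_ereal[OF virtual_energy] rate_limit]) simp
  have "\<forall>\<^sub>F \<beta> in at_top. ereal (G \<beta> x) + log_rate \<beta> (P \<beta> x y) = ereal (G \<beta> y) + log_rate \<beta> (P \<beta> y x)"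
    using eventually_gt_at_top[of 0]
  proof eventually_elim
    case (elim \<beta>)
    have st: "0 \<le> P \<beta> x y" for x y
      using stochastic[OF elim] by (auto simp: stochastic_matrix_def)
    have db: "P \<beta> x y * exp (- \<beta> * G \<beta> x) = P \<beta> y x * exp (- \<beta> * G \<beta> y)"
      by (rule detailed_balance[OF elim])
    show ?case
    proof (cases "P \<beta> x y = 0")
      case True
      then show ?thesis using db by (simp add: log_rate_def)
    next
      case False
      then have pos: "0 < P \<beta> x y" "0 < P \<beta> y x" using db st[of x y] st[of y x] by (auto simp: order_le_less)
      from arg_cong[OF db, of ln] have "ln (P \<beta> x y) - \<beta> * G \<beta> x = ln (P \<beta> y x) - \<beta> * G \<beta> y"
        using pos by (simp add: ln_mult)
      then have "G \<beta> x - ln (P \<beta> x y) / \<beta> = G \<beta> y - ln (P \<beta> y x) / \<beta>"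
        using elim by (simp add: field_simps)
      then show ?thesis using pos by (simp add: log_rate_def)
    qed
  qed
  from Lim_transform_eventually[OF lim[of x y] this] lim[of y x] show ?thesis
    unfolding transition_energy_def by (rule tendsto_unique[OF trivial_limit_at_top_linorder])
qed

lemma below_sym: "(x, y) \<in> (below H \<Delta> \<phi>)\<^sup>* \<Longrightarrow> (y, x) \<in> (below H \<Delta> \<phi>)\<^sup>*"
proof -
  have "sym (below H \<Delta> \<phi>)" by (auto simp: sym_def below_def transition_energy_sym)
  then show "(x, y) \<in> (below H \<Delta> \<phi>)\<^sup>* \<Longrightarrow> (y, x) \<in> (below H \<Delta> \<phi>)\<^sup>*"
    using sym_rtrancl symD by metis
qed

text \<open>Only a real lower bound on the rate enters, so an infinite rate is covered with every
  \<open>a\<close>.\<close>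

lemma exp_upper_rate:
  assumes "ereal a \<le> \<Delta> x y"
  shows "exp_upper (\<lambda>\<beta>. P \<beta> x y) a"
  unfolding exp_upper_def
proof (intro allI impI)
  fix \<epsilon> :: real assume "\<epsilon> > 0"
  then have "ereal (a - \<epsilon>) < \<Delta> x y" using assms by (metis diff_less less_ereal.simps(1) order.strict_trans2 diff_strict_left_mono diff_zero)
  from order_tendstoD(1)[OF rate_limit this] eventually_gt_at_top[of 0]
  show "\<forall>\<^sub>F \<beta> in at_top. P \<beta> x y \<le> exp (- \<beta> * (a - \<epsilon>))"
  proof eventually_elim
    case (elim \<beta>)
    have st: "0 \<le> P \<beta> x y" using stochastic[OF elim(2)] by (auto simp: stochastic_matrix_def)
    show ?case
    proof (cases "P \<beta> x y = 0")
      case False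
      then have "ln (P \<beta> x y) \<le> - \<beta> * (a - \<epsilon>)"
        using elim by (simp add: log_rate_def field_simps)
      then have "exp (ln (P \<beta> x y)) \<le> exp (- \<beta> * (a - \<epsilon>))" by (simp only: exp_le_cancel_iff)
      then show ?thesis using False st by simp
    qed simp
  qed
qed

lemma exp_lower_rate:
  assumes "\<Delta> x y \<le> ereal a"
  shows "exp_lower (\<lambda>\<beta>. P \<beta> x y) a"
  unfolding exp_lower_def
proof (intro allI impI)
  fix \<epsilon> :: real assume "\<epsilon> > 0"
  then have "\<Delta> x y < ereal (a + \<epsilon>)" using assms by (metis less_add_same_cancel1 less_ereal.simps(1) order.strict_trans1)
  from order_tendstoD(2)[OF rate_limit this] eventually_gt_at_top[of 0]
  show "\<forall>\<^sub>F \<beta> in at_top. exp (- \<beta> * (a + \<epsilon>)) \<le> P \<beta> x y"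
  proof eventually_elim
    case (elim \<beta>)
    have "P \<beta> x y \<noteq> 0" using elim(1) by (auto simp: log_rate_def)
    moreover have "0 \<le> P \<beta> x y" using stochastic[OF elim(2)] by (auto simp: stochastic_matrix_def)
    ultimately have pos: "0 < P \<beta> x y" by simp
    then have "- \<beta> * (a + \<epsilon>) \<le> ln (P \<beta> x y)" using elim by (simp add: log_rate_def field_simps)
    then have "exp (- \<beta> * (a + \<epsilon>)) \<le> exp (ln (P \<beta> x y))" by (simp only: exp_le_cancel_iff)
    then show ?case using pos by simp
  qed
qed

text \<open>The exponential rate of the partition function, by which the rates of Gibbs weights and
  capacities are shifted.\<close>

definition ground_energy :: real where
  "ground_energy = Min (range H)"

lemma exp_partition:
  shows "exp_upper (\<lambda>\<beta>. \<Sum>y\<in>UNIV. exp (- \<beta> * G \<beta> y)) ground_energy"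
    and "exp_lower (\<lambda>\<beta>. \<Sum>y\<in>UNIV. exp (- \<beta> * G \<beta> y)) ground_energy"
proof -
  show "exp_upper (\<lambda>\<beta>. \<Sum>y\<in>UNIV. exp (- \<beta> * G \<beta> y)) ground_energy"
  proof (rule exp_upper_sum)
    fix y show "exp_upper (\<lambda>\<beta>. exp (- \<beta> * G \<beta> y)) ground_energy"
      by (rule exp_upper_mono[OF exp_upper_tendsto[OF virtual_energy[of y]]])
         (auto simp: ground_energy_def)
  qed auto
  have "ground_energy \<in> range H" unfolding ground_energy_def by (rule Min_in) auto
  then obtain x where x: "ground_energy = H x" by auto
  show "exp_lower (\<lambda>\<beta>. \<Sum>y\<in>UNIV. exp (- \<beta> * G \<beta> y)) ground_energy"
    unfolding x
  proof (rule exp_lower_mono[OF exp_lower_tendsto[OF virtual_energy]], intro always_eventually allI)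
    fix \<beta> show "exp (- \<beta> * G \<beta> x) \<le> (\<Sum>y\<in>UNIV. exp (- \<beta> * G \<beta> y))"
      by (rule member_le_sum[of x UNIV "\<lambda>y. exp (- \<beta> * G \<beta> y)"]) simp_all
  qed
qed

lemma
  shows exp_upper_gibbs: "exp_upper (\<lambda>\<beta>. gibbs \<beta> (G \<beta>) {y}) (H y - ground_energy)"
    and exp_lower_gibbs: "exp_lower (\<lambda>\<beta>. gibbs \<beta> (G \<beta>) {y}) (H y - ground_energy)"
proof -
  have pos: "0 < (\<Sum>y\<in>UNIV. exp (- \<beta> * G \<beta> y))" for \<beta> by (rule sum_pos) auto
  have "exp_upper (\<lambda>\<beta>. exp (- \<beta> * G \<beta> y) * inverse (\<Sum>y\<in>UNIV. exp (- \<beta> * G \<beta> y)))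
      (H y + - ground_energy)"
    by (intro exp_upper_mult exp_upper_tendsto[OF virtual_energy] exp_upper_inverse exp_partition
        always_eventually allI) (simp_all only: pos less_imp_le exp_ge_zero inverse_nonnegative_iff_nonnegative)
  then show "exp_upper (\<lambda>\<beta>. gibbs \<beta> (G \<beta>) {y}) (H y - ground_energy)"
    by (simp add: gibbs_def divide_inverse)
  have "exp_lower (\<lambda>\<beta>. exp (- \<beta> * G \<beta> y) * inverse (\<Sum>y\<in>UNIV. exp (- \<beta> * G \<beta> y)))
      (H y + - ground_energy)"
    by (intro exp_lower_mult exp_lower_tendsto[OF virtual_energy] exp_lower_inverse exp_partition
        always_eventually allI pos)
  then show "exp_lower (\<lambda>\<beta>. gibbs \<beta> (G \<beta>) {y}) (H y - ground_energy)"
    by (simp add: gibbs_def divide_inverse)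
qed

lemma rate_nonneg_eventually: "\<forall>\<^sub>F \<beta> in at_top. 0 \<le> P \<beta> x y"
  using eventually_gt_at_top[of 0]
  by eventually_elim (use stochastic in \<open>auto simp: stochastic_matrix_def\<close>)

lemma exp_upper_conductance:
  assumes "ereal \<phi> \<le> transition_energy H \<Delta> z w"
  shows "exp_upper (\<lambda>\<beta>. gibbs \<beta> (G \<beta>) {z} * P \<beta> z w) (\<phi> - ground_energy)"
proof -
  have "ereal (\<phi> - H z) \<le> \<Delta> z w"
    using assms by (cases "\<Delta> z w") (auto simp: transition_energy_def)
  from exp_upper_mult[OF exp_upper_gibbs[of z] _ exp_upper_rate[OF this] rate_nonneg_eventually]
  show ?thesis by (simp add: gibbs_nonneg)
qed

lemma exp_lower_conductance:
  assumes "transition_energy H \<Delta> z w \<le> ereal \<phi>"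
  shows "exp_lower (\<lambda>\<beta>. gibbs \<beta> (G \<beta>) {z} * P \<beta> z w) (\<phi> - ground_energy)"
proof -
  have "\<Delta> z w \<le> ereal (\<phi> - H z)"
    using assms by (cases "\<Delta> z w") (auto simp: transition_energy_def)
  from exp_lower_mult[OF exp_lower_gibbs[of z] exp_lower_rate[OF this]]
  show ?thesis by simp
qed

section \<open>Capacities on the exponential scale\<close>

lemma capacity_eq_cap:
  assumes "reversible_chain (P \<beta>) (\<lambda>y. gibbs \<beta> (G \<beta>) {y})"
  shows "reversible_chain.capacity (P \<beta>) (\<lambda>y. gibbs \<beta> (G \<beta>) {y}) Y Z = cap \<beta> (G \<beta>) (P \<beta>) Y Z"
  unfolding reversible_chain.capacity_def[OF assms] reversible_chain.energy_def[OF assms]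
    cap_def dirichlet_form_def power2_eq_square ..

text \<open>The cut bound: finitely many edges leave \<open>C\<close>, and the energy of each is at
  least \<open>\<phi>\<close>.\<close>

lemma exp_upper_cap:
  assumes "y \<in> C" "C \<inter> S = {}"
    and exits: "\<And>z w. z \<in> C \<Longrightarrow> w \<notin> C \<Longrightarrow> ereal \<phi> \<le> transition_energy H \<Delta> z w"
  shows "exp_upper (\<lambda>\<beta>. cap \<beta> (G \<beta>) (P \<beta>) {y} S) (\<phi> - ground_energy)"
proof (rule exp_upper_mono[OF _ _ order_refl])
  have nn: "\<forall>\<^sub>F \<beta> in at_top. 0 \<le> gibbs \<beta> (G \<beta>) {z} * P \<beta> z w" for z w
    using rate_nonneg_eventually[of z w] by eventually_elim (simp add: gibbs_nonneg)
  have nn': "\<forall>\<^sub>F \<beta> in at_top. 0 \<le> (\<Sum>w\<in>- C. gibbs \<beta> (G \<beta>) {z} * P \<beta> z w)" for z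
  proof -
    have "\<forall>\<^sub>F \<beta> in at_top. \<forall>w. 0 \<le> gibbs \<beta> (G \<beta>) {z} * P \<beta> z w"
      using nn by (simp add: eventually_all_finite)
    then show ?thesis by eventually_elim (simp add: sum_nonneg)
  qed
  show "exp_upper (\<lambda>\<beta>. \<Sum>z\<in>C. \<Sum>w\<in>- C. gibbs \<beta> (G \<beta>) {z} * P \<beta> z w) (\<phi> - ground_energy)"
    by (intro exp_upper_sum exp_upper_conductance exits nn nn') auto
  show "\<forall>\<^sub>F \<beta> in at_top. cap \<beta> (G \<beta>) (P \<beta>) {y} S \<le> (\<Sum>z\<in>C. \<Sum>w\<in>- C. gibbs \<beta> (G \<beta>) {z} * P \<beta> z w)"
    using reversible_chain_eventually
    by eventually_elim
       (use reversible_chain.capacity_le_cut[OF _ assms(1,2)] in \<open>simp flip: capacity_eq_cap\<close>)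
qed

text \<open>Only finitely many edges lie below \<open>\<phi>\<close>, so their energies stay below
  some \<open>\<psi> < \<phi>\<close>. This strict gap later turns into exponential decay.\<close>

lemma exp_lower_cap:
  assumes path: "(y, t) \<in> (below H \<Delta> \<phi>)\<^sup>*" and t: "t \<in> T" and y: "y \<notin> T"
  obtains \<psi> where "\<psi> < \<phi>" "exp_lower (\<lambda>\<beta>. cap \<beta> (G \<beta>) (P \<beta>) {y} T) (\<psi> - ground_energy)"
proof -
  let ?R = "below H \<Delta> \<phi>"
  from path y t have ne: "?R \<noteq> {}" by auto
  have fin: "finite ?R" by simp
  define E where "E = Max ((\<lambda>(z, w). transition_energy H \<Delta> z w) ` ?R)"
  have "E < ereal \<phi>" unfolding E_def using ne fin by (subst Max_less_iff) (auto simp: below_def)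
  then obtain \<psi> where \<psi>: "E < ereal \<psi>" "ereal \<psi> < ereal \<phi>" using ereal_dense2 by blast
  have le: "transition_energy H \<Delta> z w \<le> ereal \<psi>" if "(z, w) \<in> ?R" for z w
  proof -
    have "transition_energy H \<Delta> z w \<le> E" unfolding E_def using fin that by (intro Max_ge) force+
    then show ?thesis using \<psi>(1) by simp
  qed
  obtain n where n: "(y, t) \<in> ?R ^^ n" using path rtrancl_power by blast
  have "n \<noteq> 0" using n y t by (cases n) auto
  have "exp_lower (\<lambda>\<beta>. cap \<beta> (G \<beta>) (P \<beta>) {y} T) (\<psi> - ground_energy)"
  proof -
    \<comment> \<open>The least conductance over all edges below \<open>\<phi>\<close>, as required
      by the path bound.\<close>
    define c where "c \<beta> = Min ((\<lambda>(z, w). gibbs \<beta> (G \<beta>) {z} * P \<beta> z w) ` ?R)" for \<beta>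
    have c_le: "c \<beta> \<le> gibbs \<beta> (G \<beta>) {z} * P \<beta> z w" if "(z, w) \<in> ?R" for \<beta> z w
      unfolding c_def using fin that by (intro Min_le) force+
    have "exp_lower c (\<psi> - ground_energy)"
      unfolding exp_lower_def
    proof (intro allI impI)
      fix \<epsilon> :: real assume "\<epsilon> > 0"
      then have "\<forall>\<^sub>F \<beta> in at_top. \<forall>(z, w)\<in>?R. exp (- \<beta> * (\<psi> - ground_energy + \<epsilon>)) \<le> gibbs \<beta> (G \<beta>) {z} * P \<beta> z w"
        using exp_lower_conductance[OF le] fin
        by (intro eventually_ball_finite) (auto simp: exp_lower_def)
      then show "\<forall>\<^sub>F \<beta> in at_top. exp (- \<beta> * (\<psi> - ground_energy + \<epsilon>)) \<le> c \<beta>"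
        by eventually_elim (unfold c_def, subst Min_ge_iff, use fin ne in auto)
    qed
    \<comment> \<open>The path length does not depend on \<open>\<beta>\<close>, so its factor has
      rate 0.\<close>
    moreover have "exp_lower (\<lambda>_. inverse (2 * (real n)\<^sup>2)) 0"
    proof -
      have "exp_upper (\<lambda>_. 2 * (real n)\<^sup>2 * 1) 0"
        by (rule exp_upper_cmult) (auto simp: exp_upper_def intro: eventually_mono[OF eventually_gt_at_top[of 0]])
      from exp_lower_inverse[OF this] \<open>n \<noteq> 0\<close> show ?thesis by simp
    qed
    ultimately have "exp_lower (\<lambda>\<beta>. inverse (2 * (real n)\<^sup>2) * c \<beta>) (0 + (\<psi> - ground_energy))"
      by (intro exp_lower_mult)
    then have low: "exp_lower (\<lambda>\<beta>. inverse (2 * (real n)\<^sup>2) * c \<beta>) (\<psi> - ground_energy)" by simp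
    have "\<forall>\<^sub>F \<beta> in at_top. 0 < c \<beta>"
    proof -
      have "\<forall>\<^sub>F \<beta> in at_top. exp (- \<beta> * (\<psi> - ground_energy + 1)) \<le> c \<beta>"
        using \<open>exp_lower c _\<close> unfolding exp_lower_def by (metis zero_less_one)
      then show ?thesis by eventually_elim (rule order.strict_trans2[OF exp_gt_zero])
    qed
    with reversible_chain_eventually
    have "\<forall>\<^sub>F \<beta> in at_top. inverse (2 * (real n)\<^sup>2) * c \<beta> \<le> cap \<beta> (G \<beta>) (P \<beta>) {y} T"
    proof eventually_elim
      case (elim \<beta>)
      have "c \<beta> \<le> 2 * (real n)\<^sup>2 * cap \<beta> (G \<beta>) (P \<beta>) {y} T"
        unfolding capacity_eq_cap[OF elim(1), symmetric]
        by (rule reversible_chain.capacity_ge_path[OF elim(1) n t y elim(2) c_le])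
      then show ?case using \<open>n \<noteq> 0\<close> by (simp add: field_simps)
    qed
    with low show ?thesis by (rule exp_lower_mono)
  qed
  with \<psi>(2) that show ?thesis by simp
qed

section \<open>Concentration of equilibrium potentials\<close>

text \<open>On \<open>T\<close> the potential is 0. Above the level \<open>\<eta>\<close> the Gibbs
  ratio alone decays. Otherwise the potential is at most the quotient of the capacities from
  \<open>y\<close> to \<open>S\<close> and to \<open>T\<close>; \<open>sep\<close> makes the first
  small and \<open>desc\<close> keeps the second large.\<close>

lemma equilibrium_mass_negligible:
  assumes ST: "S \<inter> T = {}" "S \<noteq> {}" "T \<noteq> {}" and \<eta>: "\<And>s. s \<in> S \<Longrightarrow> H s = \<eta>" and y: "y \<notin> S"
    and sep: "\<And>s. y \<notin> T \<Longrightarrow> H y \<le> \<eta> \<Longrightarrow> s \<in> S \<Longrightarrow> (y, s) \<notin> (below H \<Delta> (\<eta> + \<gamma>))\<^sup>*"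
    and desc: "y \<notin> T \<Longrightarrow> H y \<le> \<eta> \<Longrightarrow> \<exists>t\<in>T. (y, t) \<in> (below H \<Delta> (H y + \<gamma>))\<^sup>*"
  shows "((\<lambda>\<beta>. gibbs \<beta> (G \<beta>) {y} * equilibrium (P \<beta>) S T y / gibbs \<beta> (G \<beta>) S) \<longlongrightarrow> 0) at_top"
proof -
  let ?m = "\<lambda>\<beta>. gibbs \<beta> (G \<beta>)" and ?h = "\<lambda>\<beta>. equilibrium (P \<beta>) S T y"
  have mS: "exp_upper (\<lambda>\<beta>. inverse (?m \<beta> S)) (- (\<eta> - ground_energy))"
  proof (rule exp_upper_inverse)
    obtain s where s: "s \<in> S" using ST by blast
    show "exp_lower (\<lambda>\<beta>. ?m \<beta> S) (\<eta> - ground_energy)"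
      unfolding \<eta>[OF s, symmetric]
    proof (rule exp_lower_mono[OF exp_lower_gibbs], intro always_eventually allI)
      fix \<beta> show "?m \<beta> {s} \<le> ?m \<beta> S"
        unfolding gibbs_eq_sum[of _ _ S] using s
        by (intro member_le_sum[of s S "\<lambda>y. ?m \<beta> {y}"]) (simp_all add: gibbs_nonneg)
    qed
  qed
  have nn: "\<forall>\<^sub>F \<beta> in at_top. 0 \<le> ?h \<beta> \<and> ?h \<beta> \<le> 1"
    using irreducible_chain_eventually
    by eventually_elim (use ST in \<open>auto intro!: irreducible_chain.equilibrium_nonneg irreducible_chain.equilibrium_le_one\<close>)
  have nonneg: "\<forall>\<^sub>F \<beta> in at_top. 0 \<le> ?m \<beta> {y} * ?h \<beta> / ?m \<beta> S"
    using nn by eventually_elim (simp add: gibbs_nonneg)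
  consider "y \<in> T" | "y \<notin> T" "\<eta> < H y" | "y \<notin> T" "H y \<le> \<eta>" by fastforce
  then show ?thesis
  proof cases
    case 1
    have "\<forall>\<^sub>F \<beta> in at_top. ?m \<beta> {y} * ?h \<beta> / ?m \<beta> S = 0"
      using irreducible_chain_eventually
      by eventually_elim (simp add: irreducible_chain.equilibrium_zero[OF _ ST(1) 1])
    then show ?thesis by (rule tendsto_eventually)
  next
    case 2
    have "exp_upper (\<lambda>\<beta>. ?m \<beta> {y} * inverse (?m \<beta> S)) (H y - ground_energy + - (\<eta> - ground_energy))"
      by (intro exp_upper_mult exp_upper_gibbs mS) (simp_all add: gibbs_nonneg)
    then have "exp_upper (\<lambda>\<beta>. ?m \<beta> {y} * ?h \<beta> / ?m \<beta> S) (H y - \<eta>)"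
    proof (rule exp_upper_mono)
      show "\<forall>\<^sub>F \<beta> in at_top. ?m \<beta> {y} * ?h \<beta> / ?m \<beta> S \<le> ?m \<beta> {y} * inverse (?m \<beta> S)"
        using nn by eventually_elim
          (auto simp: divide_inverse gibbs_nonneg intro!: mult_right_mono mult_left_le)
    qed simp
    then show ?thesis by (rule exp_upper_tendsto_0[OF _ nonneg]) (use 2 in simp)
  next
    case 3
    obtain t where t: "t \<in> T" "(y, t) \<in> (below H \<Delta> (H y + \<gamma>))\<^sup>*" using desc[OF 3] by blast
    obtain \<psi> where \<psi>: "\<psi> < H y + \<gamma>"
      "exp_lower (\<lambda>\<beta>. cap \<beta> (G \<beta>) (P \<beta>) {y} T) (\<psi> - ground_energy)"
      by (rule exp_lower_cap[OF t(2,1) 3(1)])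
    \<comment> \<open>The states reachable below \<open>\<eta> + \<gamma>\<close> form a cut between
      \<open>y\<close> and \<open>S\<close>, whose exits all have energy at least
      \<open>\<eta> + \<gamma>\<close>.\<close>
    define C where "C = {z. (y, z) \<in> (below H \<Delta> (\<eta> + \<gamma>))\<^sup>*}"
    have up: "exp_upper (\<lambda>\<beta>. cap \<beta> (G \<beta>) (P \<beta>) {y} S) (\<eta> + \<gamma> - ground_energy)"
    proof (rule exp_upper_cap)
      show "y \<in> C" by (simp add: C_def)
      show "C \<inter> S = {}" using sep[OF 3] by (auto simp: C_def)
      show "ereal (\<eta> + \<gamma>) \<le> transition_energy H \<Delta> z w" if "z \<in> C" "w \<notin> C" for z w
      proof (rule ccontr)
        assume "\<not> ?thesis"
        then have "(z, w) \<in> below H \<Delta> (\<eta> + \<gamma>)" by (simp add: below_def)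
        then show False using that by (auto simp: C_def intro: rtrancl_into_rtrancl)
      qed
    qed
    have capnn: "\<forall>\<^sub>F \<beta> in at_top. 0 \<le> cap \<beta> (G \<beta>) (P \<beta>) {y} Z" if "y \<notin> Z" for Z
      using reversible_chain_eventually
      by eventually_elim (use that reversible_chain.capacity_nonneg[of "P _" _ "{y}" Z] in
        \<open>simp flip: capacity_eq_cap\<close>)
    \<comment> \<open>\<open>\<eta>\<close> and the ground energy cancel; the total rate is
      \<open>H y + \<gamma> - \<psi>\<close>, positive by the choice of
      \<open>\<psi>\<close>.\<close>
    have "exp_upper (\<lambda>\<beta>. (?m \<beta> {y} * inverse (?m \<beta> S)) *
        (cap \<beta> (G \<beta>) (P \<beta>) {y} S * inverse (cap \<beta> (G \<beta>) (P \<beta>) {y} T)))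
        (H y - ground_energy + - (\<eta> - ground_energy) + (\<eta> + \<gamma> - ground_energy + - (\<psi> - ground_energy)))"
    proof (intro exp_upper_mult exp_upper_gibbs mS up exp_upper_inverse \<psi>(2) capnn[OF y])
      show "\<forall>\<^sub>F \<beta> in at_top. 0 \<le> inverse (cap \<beta> (G \<beta>) (P \<beta>) {y} T)"
        using capnn[OF 3(1)] by eventually_elim simp
      show "\<forall>\<^sub>F \<beta> in at_top. 0 \<le> cap \<beta> (G \<beta>) (P \<beta>) {y} S * inverse (cap \<beta> (G \<beta>) (P \<beta>) {y} T)"
        using capnn[OF y] capnn[OF 3(1)] by eventually_elim simp
    qed (simp_all add: gibbs_nonneg)
    then have "exp_upper (\<lambda>\<beta>. ?m \<beta> {y} * ?h \<beta> / ?m \<beta> S) (H y + \<gamma> - \<psi>)"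
    proof (rule exp_upper_mono)
      have "\<forall>\<^sub>F \<beta> in at_top. exp (- \<beta> * (\<psi> - ground_energy + 1)) \<le> cap \<beta> (G \<beta>) (P \<beta>) {y} T"
        using \<psi>(2) unfolding exp_lower_def by (metis zero_less_one)
      then have "\<forall>\<^sub>F \<beta> in at_top. 0 < cap \<beta> (G \<beta>) (P \<beta>) {y} T"
        by eventually_elim (rule order.strict_trans2[OF exp_gt_zero])
      with reversible_chain_eventually
      show "\<forall>\<^sub>F \<beta> in at_top. ?m \<beta> {y} * ?h \<beta> / ?m \<beta> S \<le> (?m \<beta> {y} * inverse (?m \<beta> S)) *
        (cap \<beta> (G \<beta>) (P \<beta>) {y} S * inverse (cap \<beta> (G \<beta>) (P \<beta>) {y} T))"
      proof eventually_elim
        case (elim \<beta>)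
        have "?h \<beta> * cap \<beta> (G \<beta>) (P \<beta>) {y} T \<le> cap \<beta> (G \<beta>) (P \<beta>) {y} S"
          unfolding capacity_eq_cap[OF elim(1), symmetric]
          by (rule reversible_chain.equilibrium_le_capacity_quotient[OF elim(1) y 3(1) ST])
        then have "?h \<beta> \<le> cap \<beta> (G \<beta>) (P \<beta>) {y} S * inverse (cap \<beta> (G \<beta>) (P \<beta>) {y} T)"
          using elim(2) by (simp add: field_simps)
        then have "(?m \<beta> {y} * inverse (?m \<beta> S)) * ?h \<beta> \<le> (?m \<beta> {y} * inverse (?m \<beta> S)) *
          (cap \<beta> (G \<beta>) (P \<beta>) {y} S * inverse (cap \<beta> (G \<beta>) (P \<beta>) {y} T))"
          by (intro mult_left_mono) (simp_all add: gibbs_nonneg)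
        then show ?case by (simp add: divide_inverse mult_ac)
      qed
    qed simp
    then show ?thesis by (rule exp_upper_tendsto_0[OF _ nonneg]) (use \<psi>(1) in simp)
  qed
qed

text \<open>The potential is 1 on \<open>S\<close>, which contributes exactly its Gibbs mass; each
  of the finitely many other states has a negligible share.\<close>

lemma equilibrium_mass_asymptotics:
  assumes ST: "S \<inter> T = {}" "S \<noteq> {}" "T \<noteq> {}" and \<eta>: "\<And>s. s \<in> S \<Longrightarrow> H s = \<eta>"
    and sep: "\<And>y s. y \<notin> S \<union> T \<Longrightarrow> H y \<le> \<eta> \<Longrightarrow> s \<in> S \<Longrightarrow> (y, s) \<notin> (below H \<Delta> (\<eta> + \<gamma>))\<^sup>*"
    and desc: "\<And>y. y \<notin> S \<union> T \<Longrightarrow> H y \<le> \<eta> \<Longrightarrow> \<exists>t\<in>T. (y, t) \<in> (below H \<Delta> (H y + \<gamma>))\<^sup>*"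
  shows "((\<lambda>\<beta>. (\<Sum>y\<in>UNIV. gibbs \<beta> (G \<beta>) {y} * equilibrium (P \<beta>) S T y) / gibbs \<beta> (G \<beta>) S) \<longlongrightarrow> 1) at_top"
proof -
  let ?m = "\<lambda>\<beta>. gibbs \<beta> (G \<beta>)" and ?h = "\<lambda>\<beta>. equilibrium (P \<beta>) S T"
  have "((\<lambda>\<beta>. 1 + (\<Sum>y\<in>- S. ?m \<beta> {y} * ?h \<beta> y / ?m \<beta> S)) \<longlongrightarrow> 1 + (\<Sum>y\<in>- S. 0)) at_top"
    by (intro tendsto_intros equilibrium_mass_negligible[OF ST \<eta>]) (use sep desc in auto)
  then have "((\<lambda>\<beta>. 1 + (\<Sum>y\<in>- S. ?m \<beta> {y} * ?h \<beta> y / ?m \<beta> S)) \<longlongrightarrow> 1) at_top" by simp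
  moreover have "\<forall>\<^sub>F \<beta> in at_top. 1 + (\<Sum>y\<in>- S. ?m \<beta> {y} * ?h \<beta> y / ?m \<beta> S) =
      (\<Sum>y\<in>UNIV. ?m \<beta> {y} * ?h \<beta> y) / ?m \<beta> S"
    using irreducible_chain_eventually
  proof eventually_elim
    case (elim \<beta>)
    have "(\<Sum>y\<in>UNIV. ?m \<beta> {y} * ?h \<beta> y) = (\<Sum>y\<in>S \<union> - S. ?m \<beta> {y} * ?h \<beta> y)" by simp
    also have "\<dots> = (\<Sum>y\<in>S. ?m \<beta> {y} * ?h \<beta> y) + (\<Sum>y\<in>- S. ?m \<beta> {y} * ?h \<beta> y)"
      by (rule sum.union_disjoint) auto
    also have "(\<Sum>y\<in>S. ?m \<beta> {y} * ?h \<beta> y) = ?m \<beta> S"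
      unfolding gibbs_eq_sum[of _ _ S]
      by (rule sum.cong) (simp_all add: irreducible_chain.equilibrium_one[OF elim])
    finally show ?case
      using gibbs_pos[OF ST(2), of \<beta> "G \<beta>"] by (simp add: add_divide_distrib sum_divide_distrib)
  qed
  ultimately show ?thesis by (rule Lim_transform_eventually)
qed

section \<open>Stability levels and descent in the landscape\<close>

text \<open>Rates are nonnegative, so already the first edge of a path from \<open>x\<close> has
  energy at least \<open>H x\<close>.\<close>

lemma stability_level_nonneg: "0 \<le> stability_level H \<Delta> x"
proof (rule ccontr)
  assume "\<not> ?thesis"
  then have "stability_level H \<Delta> x < ereal 0" by (simp add: zero_ereal_def)
  then obtain y where y: "H y < H x" "(x, y) \<in> (below H \<Delta> (H x + 0))\<^sup>*"
    unfolding stability_level_less_iff by blast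
  from y(2) show False
  proof (cases rule: converse_rtranclE)
    case (step w)
    then have "ereal (H x) + \<Delta> x w < ereal (H x)" by (simp add: below_def transition_energy_def)
    moreover have "ereal (H x) + 0 \<le> ereal (H x) + \<Delta> x w" by (intro add_left_mono rate_nonneg)
    ultimately show False by simp
  qed (use y(1) in simp)
qed

text \<open>Irreducibility gives a path of finite rates, and the finitely many finite transition
  energies have a common bound.\<close>

lemma stability_level_finite:
  assumes "H y < H x"
  shows "stability_level H \<Delta> x < \<infinity>"
proof -
  \<comment> \<open>The inserted 0 keeps \<open>Max\<close> off the empty set.\<close>
  define E where "E = Max (insert 0 ((\<lambda>(z, w). transition_energy H \<Delta> z w) ` {(z, w). \<Delta> z w < \<infinity>}))"
  have "E < \<infinity>" unfolding E_def by (subst Max_less_iff) (auto simp: transition_energy_def)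
  then obtain \<phi> where \<phi>: "E < ereal \<phi>" using ereal_dense2 by blast
  have below: "(z, w) \<in> below H \<Delta> \<phi>" if "\<Delta> z w < \<infinity>" for z w
  proof -
    have "transition_energy H \<Delta> z w \<le> E" unfolding E_def using that by (intro Max_ge) force+
    then show ?thesis using \<phi> by (simp add: below_def)
  qed
  obtain \<omega> where \<omega>: "path_between x y \<omega>"
    "\<And>i. Suc i < length \<omega> \<Longrightarrow> \<Delta> (\<omega> ! i) (\<omega> ! Suc i) < \<infinity>"
    using rate_irreducible unfolding irreducible_rate_def by blast
  then have "(x, y) \<in> (below H \<Delta> (H x + (\<phi> - H x)))\<^sup>*"
    by (intro path_imp_rtrancl[OF \<omega>(1)]) (simp add: below)
  then have "stability_level H \<Delta> x < ereal (\<phi> - H x)"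
    unfolding stability_level_less_iff using assms by blast
  then show ?thesis by (rule order.strict_trans) simp
qed

text \<open>Otherwise the reversed path from \<open>a\<close> to \<open>y\<close>, continued by a
  descent from \<open>y\<close>, would lead from \<open>a\<close> to a lower state below
  \<open>H a + \<gamma>\<close>, against the stability level of \<open>a\<close>.\<close>

lemma below_unreachable:
  assumes a: "stability_level H \<Delta> a = ereal \<gamma>" and y: "stability_level H \<Delta> y < ereal \<gamma>"
    and le: "H y \<le> H a"
  shows "(y, a) \<notin> (below H \<Delta> (H a + \<gamma>))\<^sup>*"
proof
  assume "(y, a) \<in> (below H \<Delta> (H a + \<gamma>))\<^sup>*"
  then have "(a, y) \<in> (below H \<Delta> (H a + \<gamma>))\<^sup>*" by (rule below_sym)
  moreover obtain z where z: "H z < H y" "(y, z) \<in> (below H \<Delta> (H y + \<gamma>))\<^sup>*"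
    using y unfolding stability_level_less_iff by blast
  have "(below H \<Delta> (H y + \<gamma>))\<^sup>* \<subseteq> (below H \<Delta> (H a + \<gamma>))\<^sup>*"
    using le by (intro rtrancl_mono below_mono) simp
  then have "(y, z) \<in> (below H \<Delta> (H a + \<gamma>))\<^sup>*" using z by blast
  ultimately have "(a, z) \<in> (below H \<Delta> (H a + \<gamma>))\<^sup>*" by (rule rtrancl_trans)
  then have "stability_level H \<Delta> a < ereal \<gamma>"
    unfolding stability_level_less_iff using z le by force
  then show False using a by simp
qed

lemma stability_level_less_max:
  assumes "x \<notin> stable_states H" "x \<notin> metastable_states H \<Delta>"
  shows "stability_level H \<Delta> x < max_stability_level H \<Delta>"
proof -
  have "stability_level H \<Delta> x \<le> max_stability_level H \<Delta>"
    unfolding max_stability_level_def using assms by (intro Max_ge) auto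
  then show ?thesis using assms by (auto simp: metastable_states_def order_le_less)
qed

text \<open>Each state outside the target set has level below \<open>\<gamma>\<close> and so reaches
  a lower state. The bounds \<open>H z + \<gamma>\<close> decrease along the iteration, so the
  joined paths stay below \<open>H y + \<gamma>\<close>; the number of strictly lower states drops
  each time.\<close>

lemma descent:
  assumes \<gamma>: "max_stability_level H \<Delta> = ereal \<gamma>"
    and "y \<notin> stable_states H \<union> metastable_states H \<Delta>"
  shows "\<exists>z\<in>stable_states H \<union> metastable_states H \<Delta>. H z < H y \<and> (y, z) \<in> (below H \<Delta> (H y + \<gamma>))\<^sup>*"
  using assms(2)
proof (induction "card {z. H z < H y}" arbitrary: y rule: less_induct)
  case less
  have "stability_level H \<Delta> y < ereal \<gamma>"
    using stability_level_less_max[of y] less.prems by (simp add: \<gamma>)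
  then obtain z where z: "H z < H y" "(y, z) \<in> (below H \<Delta> (H y + \<gamma>))\<^sup>*"
    unfolding stability_level_less_iff by blast
  show ?case
  proof (cases "z \<in> stable_states H \<union> metastable_states H \<Delta>")
    case False
    have "card {w. H w < H z} < card {w. H w < H y}"
      using z(1) by (intro psubset_card_mono) auto
    from less.hyps[OF this False] obtain w where
      w: "w \<in> stable_states H \<union> metastable_states H \<Delta>" "H w < H z" "(z, w) \<in> (below H \<Delta> (H z + \<gamma>))\<^sup>*"
      by blast
    have "(below H \<Delta> (H z + \<gamma>))\<^sup>* \<subseteq> (below H \<Delta> (H y + \<gamma>))\<^sup>*"
      using z(1) by (intro rtrancl_mono below_mono) simp
    then have "(y, w) \<in> (below H \<Delta> (H y + \<gamma>))\<^sup>*" using w(3) z(2) by (blast intro: rtrancl_trans)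
    then show ?thesis using w z(1) by (intro bexI[of _ w]) auto
  qed (use z in blast)
qed

text \<open>The quotient of potential mass and capacity factors into the relative mass, which tends
  to 1, and the ratio of Gibbs mass to capacity, whose asymptotics are given.\<close>

lemma capacity_ratio_asymptotics:
  assumes mass: "((\<lambda>\<beta>. (\<Sum>y\<in>UNIV. gibbs \<beta> (G \<beta>) {y} * equilibrium (P \<beta>) S T y) / gibbs \<beta> (G \<beta>) S)
      \<longlongrightarrow> 1) at_top"
    and cap: "(\<lambda>\<beta>. gibbs \<beta> (G \<beta>) S / cap \<beta> (G \<beta>) (P \<beta>) S T) \<sim>[at_top] (\<lambda>\<beta>. c * exp (\<beta> * \<gamma>))"
    and c: "c \<noteq> 0" and ST: "S \<noteq> {}" "S \<inter> T = {}"
  shows "((\<lambda>\<beta>. exp (- \<beta> * \<gamma>) * ((\<Sum>y\<in>UNIV. gibbs \<beta> (G \<beta>) {y} * equilibrium (P \<beta>) S T y) /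
      cap \<beta> (G \<beta>) (P \<beta>) S T)) \<longlongrightarrow> c) at_top"
    and "\<forall>\<^sub>F \<beta> in at_top. 0 < cap \<beta> (G \<beta>) (P \<beta>) S T"
proof -
  have lim: "((\<lambda>\<beta>. gibbs \<beta> (G \<beta>) S / cap \<beta> (G \<beta>) (P \<beta>) S T / (c * exp (\<beta> * \<gamma>))) \<longlongrightarrow> 1) at_top"
    by (rule asymp_equivD_strong[OF cap]) (use c in simp)
  have "((\<lambda>\<beta>. c * ((\<Sum>y\<in>UNIV. gibbs \<beta> (G \<beta>) {y} * equilibrium (P \<beta>) S T y) / gibbs \<beta> (G \<beta>) S) *
      (gibbs \<beta> (G \<beta>) S / cap \<beta> (G \<beta>) (P \<beta>) S T / (c * exp (\<beta> * \<gamma>)))) \<longlongrightarrow> c * 1 * 1) at_top"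
    by (intro tendsto_intros mass lim)
  moreover have "gibbs \<beta> (G \<beta>) S \<noteq> 0" for \<beta> using gibbs_pos[OF ST(1), of \<beta> "G \<beta>"] by simp
  ultimately show "((\<lambda>\<beta>. exp (- \<beta> * \<gamma>) * ((\<Sum>y\<in>UNIV. gibbs \<beta> (G \<beta>) {y} * equilibrium (P \<beta>) S T y) /
      cap \<beta> (G \<beta>) (P \<beta>) S T)) \<longlongrightarrow> c) at_top"
    using c by (simp add: exp_minus field_simps)
  have "\<forall>\<^sub>F \<beta> in at_top. 0 < gibbs \<beta> (G \<beta>) S / cap \<beta> (G \<beta>) (P \<beta>) S T / (c * exp (\<beta> * \<gamma>))"
    using order_tendstoD(1)[OF lim, of 0] by simp
  with reversible_chain_eventually show "\<forall>\<^sub>F \<beta> in at_top. 0 < cap \<beta> (G \<beta>) (P \<beta>) S T"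
  proof eventually_elim
    case (elim \<beta>)
    have "0 \<le> cap \<beta> (G \<beta>) (P \<beta>) S T"
      using reversible_chain.capacity_nonneg[OF elim(1) ST(2)] by (simp add: capacity_eq_cap[OF elim(1)])
    \<comment> \<open>Division by zero yields 0, so a vanishing capacity would contradict the
      positive quotient.\<close>
    moreover have "cap \<beta> (G \<beta>) (P \<beta>) S T \<noteq> 0" using elim(2) by auto
    ultimately show ?case by simp
  qed
qed

end

text \<open>Asymptotic equivalence expresses the factor \<open>1 + o(1)\<close>. The finiteness
  clause records that \<open>enn2real\<close>, which sends \<open>\<infinity>\<close> to 0, loses
  nothing.\<close>

theorem theorem2p12:
  fixes \<Delta> :: "'a::finite \<Rightarrow> 'a \<Rightarrow> ereal"
    and P :: "real \<Rightarrow> 'a \<Rightarrow> 'a \<Rightarrow> real"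
    and G :: "real \<Rightarrow> 'a \<Rightarrow> real"
    and H :: "'a \<Rightarrow> real"
    and M :: "real \<Rightarrow> 'a \<Rightarrow> 'w measure"
    and X :: "real \<Rightarrow> nat \<Rightarrow> 'w \<Rightarrow> 'a"
    and n :: nat and x0 x2 :: 'a and x1 :: "nat \<Rightarrow> 'a"
    and k1 k2 :: real
  assumes "rare_transitions \<Delta> P G H M X"
    and "n \<ge> 2" and "inj_on x1 {1..n}"
    and "x0 \<notin> x1 ` {1..n}" and "x2 \<notin> x1 ` {1..n}" and "x0 \<noteq> x2"
    and "stable_states H = {x0}"
    and "metastable_states H \<Delta> = x1 ` {1..n} \<union> {x2}"
    and "\<And>r. r \<in> {1..n} \<Longrightarrow> H x2 > H (x1 r)"
    and "\<And>r q. r \<in> {1..n} \<Longrightarrow> q \<in> {1..n} \<Longrightarrow> H (x1 r) = H (x1 q)"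
    and "\<And>r q. r \<in> {1..n} \<Longrightarrow> q \<in> {1..n} \<Longrightarrow>
           comm_height H \<Delta> (x1 r) (x1 q) - ereal (H (x1 r)) < max_stability_level H \<Delta>"
    and "\<And>r. r \<in> {1..n} \<Longrightarrow>
           ((\<lambda>\<beta>. \<P>(w in M \<beta> x2. hitting_time (X \<beta>) {x0} w < hitting_time (X \<beta>) {x1 r} w))
              \<longlongrightarrow> 0) at_top"
    and "k1 > 0" and "k2 > 0"
    and "(\<lambda>\<beta>. gibbs \<beta> (G \<beta>) {x2} / cap \<beta> (G \<beta>) (P \<beta>) {x2} (x1 ` {1..n} \<union> {x0}))
           \<sim>[at_top] (\<lambda>\<beta>. 1 / k1 * exp (\<beta> * real_of_ereal (max_stability_level H \<Delta>)))"
    and "(\<lambda>\<beta>. gibbs \<beta> (G \<beta>) (x1 ` {1..n}) / cap \<beta> (G \<beta>) (P \<beta>) (x1 ` {1..n}) {x0})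
           \<sim>[at_top] (\<lambda>\<beta>. 1 / k2 * exp (\<beta> * real_of_ereal (max_stability_level H \<Delta>)))"
  shows "(\<forall>\<^sub>F \<beta> in at_top. expected_hitting_time (M \<beta> x2) (X \<beta>) {x0} < \<infinity>) \<and>
         (\<lambda>\<beta>. enn2real (expected_hitting_time (M \<beta> x2) (X \<beta>) {x0}))
           \<sim>[at_top] (\<lambda>\<beta>. exp (\<beta> * real_of_ereal (max_stability_level H \<Delta>)) * (1 / k1 + 1 / k2))"
proof -
  interpret rare_transitions \<Delta> P G H M X by fact
  note stable = assms(7) and metastable = assms(8)
  define A where "A = x1 ` {1..n}"
  have x1A: "x1 1 \<in> A" using assms(2) by (auto simp: A_def)
  then have A: "A \<noteq> {}" "x0 \<notin> A" "x2 \<notin> A" using assms(4,5) by (auto simp: A_def)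
  define a where "a = x1 1"
  have a: "a \<in> A" using x1A by (simp add: a_def)
  define \<eta> where "\<eta> = H a"
  have HA: "H b = \<eta>" if b: "b \<in> A" for b
  proof -
    obtain r where "b = x1 r" "r \<in> {1..n}" using b by (auto simp: A_def)
    then show ?thesis using assms(10)[of r 1] assms(2) by (simp add: \<eta>_def a_def)
  qed
  have H2: "\<eta> < H x2" using assms(9)[of 1] assms(2) by (simp add: \<eta>_def a_def)
  \<comment> \<open>The maximal stability level is a real number \<open>\<gamma>\<close>: it is the
    level of \<open>x2\<close>, which is nonnegative and, as \<open>x0\<close> lies lower,
    finite.\<close>
  have "H x0 \<le> H a" using stable by (auto simp: stable_states_def)
  then have "stability_level H \<Delta> x2 < \<infinity>" using stability_level_finite[of x0 x2] H2 by (simp add: \<eta>_def)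
  moreover have meta: "stability_level H \<Delta> b = max_stability_level H \<Delta>" if "b \<in> insert x2 A" for b
    using that metastable by (auto simp: metastable_states_def A_def)
  ultimately obtain \<gamma> where \<gamma>: "max_stability_level H \<Delta> = ereal \<gamma>"
    using stability_level_nonneg[of x2] by (cases "max_stability_level H \<Delta>") auto
  have meta: "stability_level H \<Delta> b = ereal \<gamma>" if "b \<in> insert x2 A" for b
    using meta[OF that] \<gamma> by simp
  have less: "stability_level H \<Delta> y < ereal \<gamma>" if "y \<notin> insert x0 (insert x2 A)" for y
    using stability_level_less_max[of y] that \<gamma> stable metastable by (auto simp: A_def)
  have desc: "\<exists>z\<in>insert x0 (insert x2 A). H z < H y \<and> (y, z) \<in> (below H \<Delta> (H y + \<gamma>))\<^sup>*"
    if "y \<notin> insert x0 (insert x2 A)" for y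
  proof -
    have "stable_states H \<union> metastable_states H \<Delta> = insert x0 (insert x2 A)"
      by (auto simp: stable metastable A_def)
    then show ?thesis using descent[OF \<gamma>, of y] that by (simp only: simp_thms)
  qed

  \<comment> \<open>Concentration of the potentials of the pairs (\<open>x2\<close>,
    \<open>A \<union> {x0}\<close>) and (\<open>A\<close>, \<open>x0\<close>)\<close>
  have mass2: "((\<lambda>\<beta>. (\<Sum>y\<in>UNIV. gibbs \<beta> (G \<beta>) {y} * equilibrium (P \<beta>) {x2} (A \<union> {x0}) y) /
      gibbs \<beta> (G \<beta>) {x2}) \<longlongrightarrow> 1) at_top"
  proof (rule equilibrium_mass_asymptotics[where \<eta> = "H x2" and \<gamma> = \<gamma>])
    fix y assume y: "y \<notin> {x2} \<union> (A \<union> {x0})" "H y \<le> H x2"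
    show "(y, s) \<notin> (below H \<Delta> (H x2 + \<gamma>))\<^sup>*" if "s \<in> {x2}" for s
      using below_unreachable[OF meta less, of x2 y] that y by simp
    \<comment> \<open>The descent ends strictly below \<open>H y\<close>, hence below
      \<open>H x2\<close>, so it cannot end in \<open>x2\<close>.\<close>
    show "\<exists>t\<in>A \<union> {x0}. (y, t) \<in> (below H \<Delta> (H y + \<gamma>))\<^sup>*"
      using desc[of y] y by force
  qed (use A assms(6) in auto)
  have massA: "((\<lambda>\<beta>. (\<Sum>y\<in>UNIV. gibbs \<beta> (G \<beta>) {y} * equilibrium (P \<beta>) A {x0} y) /
      gibbs \<beta> (G \<beta>) A) \<longlongrightarrow> 1) at_top"
  proof (rule equilibrium_mass_asymptotics[where \<eta> = \<eta> and \<gamma> = \<gamma>])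
    fix y assume y: "y \<notin> A \<union> {x0}" "H y \<le> \<eta>"
    then have y': "y \<notin> insert x0 (insert x2 A)" using H2 by auto
    show "(y, s) \<notin> (below H \<Delta> (\<eta> + \<gamma>))\<^sup>*" if "s \<in> A" for s
      using below_unreachable[OF meta less[OF y'], of s] that y by (simp add: HA)
    \<comment> \<open>The end of the descent lies strictly below \<open>\<eta>\<close>, which
      excludes \<open>A\<close> and \<open>x2\<close> and leaves \<open>x0\<close>.\<close>
    show "\<exists>t\<in>{x0}. (y, t) \<in> (below H \<Delta> (H y + \<gamma>))\<^sup>*"
      using desc[OF y'] y(2) H2 HA by force
  qed (use A HA in auto)

  define u where "u \<beta> = mean_hitting (P \<beta>) {x0}" for \<beta>
  define v where "v \<beta> = mean_hitting (P \<beta>) (A \<union> {x0}) x2" for \<beta>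
  define g where "g \<beta> = equilibrium (P \<beta>) {x0} A x2" for \<beta>
  \<comment> \<open>The target contains \<open>x0\<close> besides \<open>c\<close>, so that
    \<open>d\<close> serves as the first stage on the way from \<open>b\<close> to
    \<open>x0\<close>.\<close>
  define d where "d b c \<beta> = mean_hitting (P \<beta>) {c, x0} b" for b c \<beta>
  \<comment> \<open>By \<open>mean_hitting_flux\<close> this is the average of \<open>u\<close> over
    the normalized equilibrium charge of \<open>A\<close>.\<close>
  define U where "U \<beta> = (\<Sum>y\<in>UNIV. gibbs \<beta> (G \<beta>) {y} * equilibrium (P \<beta>) A {x0} y) /
      cap \<beta> (G \<beta>) (P \<beta>) A {x0}" for \<beta>
  \<comment> \<open>This will bound the deviation of \<open>u\<close> on \<open>A\<close> from its
    value at \<open>a\<close>.\<close>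
  define \<delta> where "\<delta> \<beta> = (\<Sum>b\<in>A - {a}. d a b \<beta> + d b a \<beta>)" for \<beta>

  \<comment> \<open>Mean time from \<open>x2\<close> to \<open>A \<union> {x0}\<close>\<close>
  have v_lim: "((\<lambda>\<beta>. exp (- \<beta> * \<gamma>) * v \<beta>) \<longlongrightarrow> 1 / k1) at_top"
  proof -
    note * = capacity_ratio_asymptotics[OF mass2, of "1 / k1" \<gamma>]
    have cap: "(\<lambda>\<beta>. gibbs \<beta> (G \<beta>) {x2} / cap \<beta> (G \<beta>) (P \<beta>) {x2} (A \<union> {x0}))
           \<sim>[at_top] (\<lambda>\<beta>. 1 / k1 * exp (\<beta> * \<gamma>))"
      using assms(15) by (simp add: A_def \<gamma>)
    have ST: "1 / k1 \<noteq> 0" "{x2} \<noteq> {}" "{x2} \<inter> (A \<union> {x0}) = {}" using A assms(6,13) by auto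
    have "\<forall>\<^sub>F \<beta> in at_top. exp (- \<beta> * \<gamma>) * ((\<Sum>y\<in>UNIV. gibbs \<beta> (G \<beta>) {y} *
        equilibrium (P \<beta>) {x2} (A \<union> {x0}) y) / cap \<beta> (G \<beta>) (P \<beta>) {x2} (A \<union> {x0})) = exp (- \<beta> * \<gamma>) * v \<beta>"
      using *(2)[OF cap ST] reversible_chain_eventually
    proof eventually_elim
      case (elim \<beta>)
      have "v \<beta> * cap \<beta> (G \<beta>) (P \<beta>) {x2} (A \<union> {x0}) =
          (\<Sum>y\<in>UNIV. gibbs \<beta> (G \<beta>) {y} * equilibrium (P \<beta>) {x2} (A \<union> {x0}) y)"
        unfolding v_def capacity_eq_cap[OF elim(2), symmetric]
        by (rule reversible_chain.mean_hitting_singleton[OF elim(2)]) (use ST in auto)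
      then show ?case using elim(1) by (simp add: field_simps)
    qed
    with *(1)[OF cap ST] show ?thesis by (rule Lim_transform_eventually)
  qed

  have capA: "(\<lambda>\<beta>. gibbs \<beta> (G \<beta>) A / cap \<beta> (G \<beta>) (P \<beta>) A {x0})
         \<sim>[at_top] (\<lambda>\<beta>. 1 / k2 * exp (\<beta> * \<gamma>))"
    using assms(16) by (simp add: A_def \<gamma>)
  have stA: "1 / k2 \<noteq> 0" "A \<noteq> {}" "A \<inter> {x0} = {}" using A assms(14) by auto
  note U_lim = capacity_ratio_asymptotics(1)[OF massA capA stA, folded U_def]
  note capA_pos = capacity_ratio_asymptotics(2)[OF massA capA stA]

  have nonneg: "\<forall>\<^sub>F \<beta> in at_top. \<forall>b c. 0 \<le> d b c \<beta>" "\<forall>\<^sub>F \<beta> in at_top. \<forall>b. 0 \<le> u \<beta> b"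
    using irreducible_chain_eventually
    by (eventually_elim, simp add: d_def u_def irreducible_chain.mean_hitting_nonneg)+

  \<comment> \<open>Mean times between states of \<open>A\<close>\<close>
  have d_lim: "((\<lambda>\<beta>. exp (- \<beta> * \<gamma>) * d b c \<beta>) \<longlongrightarrow> 0) at_top"
    if bc: "b \<in> A" "c \<in> A" "b \<noteq> c" for b c
  proof -
    obtain r q where "b = x1 r" "c = x1 q" "r \<in> {1..n}" "q \<in> {1..n}" using bc by (auto simp: A_def)
    then have "comm_height H \<Delta> b c - ereal (H b) < ereal \<gamma>" using assms(11) \<gamma> by metis
    then have "comm_height H \<Delta> b c < ereal (\<eta> + \<gamma>)"
      using bc by (simp add: ereal_minus_less HA add.commute)
    then have path: "(b, c) \<in> (below H \<Delta> (\<eta> + \<gamma>))\<^sup>*" using bc comm_height_less_iff by metis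
    have b: "b \<notin> {c, x0}" using bc A by auto
    \<comment> \<open>Since \<open>\<psi>\<close> is strictly below
      \<open>\<eta> + \<gamma>\<close>, this capacity decays strictly slower than
      \<open>exp (- \<beta> * (\<eta> + \<gamma>))\<close>, while the mass divided by it is of order
      \<open>exp (- \<beta> * \<eta>)\<close>.\<close>
    obtain \<psi> where \<psi>: "\<psi> < \<eta> + \<gamma>"
      "exp_lower (\<lambda>\<beta>. cap \<beta> (G \<beta>) (P \<beta>) {b} {c, x0}) (\<psi> - ground_energy)"
      by (rule exp_lower_cap[OF path _ b]) auto
    have low: "\<forall>\<^sub>F \<beta> in at_top. exp (- \<beta> * (\<psi> - ground_energy + 1)) \<le> cap \<beta> (G \<beta>) (P \<beta>) {b} {c, x0}"
      using \<psi>(2) unfolding exp_lower_def by (metis zero_less_one)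
    then have cap_pos: "\<forall>\<^sub>F \<beta> in at_top. 0 < cap \<beta> (G \<beta>) (P \<beta>) {b} {c, x0}"
      by eventually_elim (rule order.strict_trans2[OF exp_gt_zero])
    have "exp_upper (\<lambda>\<beta>. gibbs \<beta> (G \<beta>) A) (\<eta> - ground_energy)"
      unfolding gibbs_eq_sum[of _ _ A]
    proof (rule exp_upper_sum)
      show "exp_upper (\<lambda>\<beta>. gibbs \<beta> (G \<beta>) {s}) (\<eta> - ground_energy)" if "s \<in> A" for s
        using exp_upper_gibbs[of s] HA[OF that] by simp
    qed (simp_all add: gibbs_nonneg)
    then have "exp_upper (\<lambda>\<beta>. 2 * gibbs \<beta> (G \<beta>) A) (\<eta> - ground_energy)"
      by (rule exp_upper_cmult) (simp add: gibbs_nonneg)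
    \<comment> \<open>The first two factors multiply to 1 and their rates cancel; the remaining rate
      is \<open>\<eta> + \<gamma> - \<psi>\<close>.\<close>
    then have "exp_upper (\<lambda>\<beta>. exp (- \<beta> * - \<gamma>) * exp (- \<beta> * \<gamma>) * (exp (- \<beta> * \<gamma>) *
        ((2 * gibbs \<beta> (G \<beta>) A) * inverse (cap \<beta> (G \<beta>) (P \<beta>) {b} {c, x0}))))
        (- \<gamma> + \<gamma> + (\<gamma> + (\<eta> - ground_energy + - (\<psi> - ground_energy))))"
    proof (intro exp_upper_mult exp_upper_inverse \<psi>(2) exp_upper_tendsto tendsto_const)
      show "\<forall>\<^sub>F \<beta> in at_top. 0 \<le> inverse (cap \<beta> (G \<beta>) (P \<beta>) {b} {c, x0})"
        using cap_pos by eventually_elim simp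
      show "\<forall>\<^sub>F \<beta> in at_top. 0 \<le> 2 * gibbs \<beta> (G \<beta>) A * inverse (cap \<beta> (G \<beta>) (P \<beta>) {b} {c, x0})"
        using cap_pos by eventually_elim (simp add: gibbs_nonneg)
      show "\<forall>\<^sub>F \<beta> in at_top. 0 \<le> exp (- \<beta> * \<gamma>) * (2 * gibbs \<beta> (G \<beta>) A * inverse (cap \<beta> (G \<beta>) (P \<beta>) {b} {c, x0}))"
        using cap_pos by eventually_elim (simp add: gibbs_nonneg)
    qed (simp_all add: gibbs_nonneg)
    then have "exp_upper (\<lambda>\<beta>. exp (- \<beta> * \<gamma>) * d b c \<beta>) (\<eta> + \<gamma> - \<psi>)"
    proof (rule exp_upper_mono)
      \<comment> \<open>The bound 2 is any number above the limit 1 of the relative mass.\<close>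
      have "\<forall>\<^sub>F \<beta> in at_top. (\<Sum>y\<in>UNIV. gibbs \<beta> (G \<beta>) {y} * equilibrium (P \<beta>) A {x0} y) /
          gibbs \<beta> (G \<beta>) A < 2" using order_tendstoD(2)[OF massA] by simp
      with cap_pos reversible_chain_eventually
      show "\<forall>\<^sub>F \<beta> in at_top. exp (- \<beta> * \<gamma>) * d b c \<beta> \<le> exp (- \<beta> * - \<gamma>) * exp (- \<beta> * \<gamma>) * (exp (- \<beta> * \<gamma>) *
        ((2 * gibbs \<beta> (G \<beta>) A) * inverse (cap \<beta> (G \<beta>) (P \<beta>) {b} {c, x0})))"
      proof eventually_elim
        case (elim \<beta>)
        interpret reversible_chain "P \<beta>" "\<lambda>y. gibbs \<beta> (G \<beta>) {y}" by fact
        have "d b c \<beta> * cap \<beta> (G \<beta>) (P \<beta>) {b} {c, x0} =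
            (\<Sum>y\<in>UNIV. gibbs \<beta> (G \<beta>) {y} * equilibrium (P \<beta>) {b} {c, x0} y)"
          unfolding d_def capacity_eq_cap[OF elim(2), symmetric]
          by (rule mean_hitting_singleton[OF b]) simp
        \<comment> \<open>Enlarging \<open>{b}\<close> to \<open>A\<close> and shrinking
          \<open>{c, x0}\<close> to \<open>{x0}\<close> raises the potential, which brings in the
          known mass.\<close>
        also have "\<dots> \<le> (\<Sum>y\<in>UNIV. gibbs \<beta> (G \<beta>) {y} * equilibrium (P \<beta>) A {x0} y)"
          by (intro sum_mono mult_left_mono equilibrium_mono gibbs_nonneg) (use b bc A in auto)
        also have "\<dots> \<le> 2 * gibbs \<beta> (G \<beta>) A"
          using elim(3) gibbs_pos[OF A(1), of \<beta> "G \<beta>"] by (simp add: field_simps)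
        finally have "d b c \<beta> \<le> 2 * gibbs \<beta> (G \<beta>) A * inverse (cap \<beta> (G \<beta>) (P \<beta>) {b} {c, x0})"
          using elim(1) by (simp add: field_simps)
        then show ?case by (simp add: exp_add[symmetric])
      qed
    qed simp
    moreover have "\<forall>\<^sub>F \<beta> in at_top. 0 \<le> exp (- \<beta> * \<gamma>) * d b c \<beta>"
      using nonneg(1) by eventually_elim simp
    ultimately show ?thesis by (rule exp_upper_tendsto_0) (use \<psi>(1) in simp)
  qed

  have \<delta>_lim: "((\<lambda>\<beta>. exp (- \<beta> * \<gamma>) * \<delta> \<beta>) \<longlongrightarrow> 0) at_top"
  proof -
    have "((\<lambda>\<beta>. \<Sum>b\<in>A - {a}. exp (- \<beta> * \<gamma>) * d a b \<beta> + exp (- \<beta> * \<gamma>) * d b a \<beta>)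
        \<longlongrightarrow> (\<Sum>b\<in>A - {a}. 0 + 0)) at_top"
      by (intro tendsto_sum tendsto_add d_lim) (use a in auto)
    then show ?thesis by (simp add: \<delta>_def sum_distrib_left distrib_left)
  qed

  have near: "\<forall>\<^sub>F \<beta> in at_top. \<forall>b\<in>A. u \<beta> b \<le> u \<beta> a + \<delta> \<beta> \<and> u \<beta> a - \<delta> \<beta> \<le> u \<beta> b"
    using irreducible_chain_eventually nonneg
  proof eventually_elim
    case (elim \<beta>)
    interpret irreducible_chain "P \<beta>" by fact
    show ?case
    proof
      fix b assume b: "b \<in> A"
      \<comment> \<open>Go from \<open>x\<close> until \<open>y\<close> or \<open>x0\<close> is
        reached, then from \<open>y\<close> to \<open>x0\<close>.\<close>
      have tri: "u \<beta> x \<le> d x y \<beta> + u \<beta> y" for x y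
        using mean_hitting_upper[of "{x0}" "u \<beta> y" "{y}" x] elim by (simp add: u_def d_def insert_commute)
      have le: "d a b \<beta> \<le> \<delta> \<beta> \<and> d b a \<beta> \<le> \<delta> \<beta>" if "b \<noteq> a"
      proof -
        have "d a b \<beta> + d b a \<beta> \<le> \<delta> \<beta>" unfolding \<delta>_def
          by (rule member_le_sum[of b "A - {a}" "\<lambda>b. d a b \<beta> + d b a \<beta>"]) (use b that elim(2) in auto)
        then show ?thesis using elim(2)[rule_format, of a b] elim(2)[rule_format, of b a] by linarith
      qed
      have "0 \<le> \<delta> \<beta>" unfolding \<delta>_def using elim(2) by (simp add: sum_nonneg)
      then show "u \<beta> b \<le> u \<beta> a + \<delta> \<beta> \<and> u \<beta> a - \<delta> \<beta> \<le> u \<beta> b"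
        using tri[of a b] tri[of b a] le by (cases "b = a") auto
    qed
  qed

  \<comment> \<open>Mean time from \<open>A\<close> to \<open>x0\<close>\<close>
  have u_lim: "((\<lambda>\<beta>. exp (- \<beta> * \<gamma>) * u \<beta> a) \<longlongrightarrow> 1 / k2) at_top"
  proof (rule tendsto_sandwich)
    \<comment> \<open>An average of values within \<open>\<delta> \<beta>\<close> of
      \<open>u \<beta> a\<close> is itself within \<open>\<delta> \<beta>\<close> of it.\<close>
    have "\<forall>\<^sub>F \<beta> in at_top. U \<beta> \<le> u \<beta> a + \<delta> \<beta> \<and> u \<beta> a - \<delta> \<beta> \<le> U \<beta>"
      using near capA_pos reversible_chain_eventually
    proof eventually_elim
      case (elim \<beta>)
      interpret reversible_chain "P \<beta>" "\<lambda>y. gibbs \<beta> (G \<beta>) {y}" by fact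
      have "(\<Sum>y\<in>UNIV. gibbs \<beta> (G \<beta>) {y} * equilibrium (P \<beta>) A {x0} y) \<le>
          (u \<beta> a + \<delta> \<beta>) * cap \<beta> (G \<beta>) (P \<beta>) A {x0}"
        unfolding capacity_eq_cap[OF elim(3), symmetric]
        by (rule mean_hitting_capacity_le) (use A elim(1) in \<open>auto simp: u_def\<close>)
      moreover have "(u \<beta> a - \<delta> \<beta>) * cap \<beta> (G \<beta>) (P \<beta>) A {x0} \<le>
          (\<Sum>y\<in>UNIV. gibbs \<beta> (G \<beta>) {y} * equilibrium (P \<beta>) A {x0} y)"
        unfolding capacity_eq_cap[OF elim(3), symmetric]
        by (rule mean_hitting_capacity_ge) (use A elim(1) in \<open>auto simp: u_def\<close>)
      ultimately show ?case using elim(2) unfolding U_def by (simp add: field_simps)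
    qed
    then have *: "\<forall>\<^sub>F \<beta> in at_top.
        exp (- \<beta> * \<gamma>) * U \<beta> - exp (- \<beta> * \<gamma>) * \<delta> \<beta> \<le> exp (- \<beta> * \<gamma>) * u \<beta> a \<and>
        exp (- \<beta> * \<gamma>) * u \<beta> a \<le> exp (- \<beta> * \<gamma>) * U \<beta> + exp (- \<beta> * \<gamma>) * \<delta> \<beta>"
      by eventually_elim (simp flip: distrib_left right_diff_distrib)
    show "\<forall>\<^sub>F \<beta> in at_top. exp (- \<beta> * \<gamma>) * U \<beta> - exp (- \<beta> * \<gamma>) * \<delta> \<beta> \<le> exp (- \<beta> * \<gamma>) * u \<beta> a"
      "\<forall>\<^sub>F \<beta> in at_top. exp (- \<beta> * \<gamma>) * u \<beta> a \<le> exp (- \<beta> * \<gamma>) * U \<beta> + exp (- \<beta> * \<gamma>) * \<delta> \<beta>"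
      using * by (auto elim: eventually_mono)
    show "((\<lambda>\<beta>. exp (- \<beta> * \<gamma>) * U \<beta> - exp (- \<beta> * \<gamma>) * \<delta> \<beta>) \<longlongrightarrow> 1 / k2) at_top"
      using tendsto_diff[OF U_lim \<delta>_lim] by simp
    show "((\<lambda>\<beta>. exp (- \<beta> * \<gamma>) * U \<beta> + exp (- \<beta> * \<gamma>) * \<delta> \<beta>) \<longlongrightarrow> 1 / k2) at_top"
      using tendsto_add[OF U_lim \<delta>_lim] by simp
  qed

  \<comment> \<open>The potential \<open>g\<close> stands for reaching \<open>x0\<close> before all
    of \<open>A\<close>, which is no more likely than reaching \<open>x0\<close> before the single
    state \<open>x1 1\<close>.\<close>
  have g_lim: "(g \<longlongrightarrow> 0) at_top"
  proof (rule tendsto_sandwich[OF _ _ tendsto_const])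
    have one: "1 \<in> {1..n}" using assms(2) by simp
    show "\<forall>\<^sub>F \<beta> in at_top. 0 \<le> g \<beta>"
      using irreducible_chain_eventually
      by eventually_elim (use A in \<open>auto simp: g_def intro!: irreducible_chain.equilibrium_nonneg\<close>)
    show "\<forall>\<^sub>F \<beta> in at_top. g \<beta> \<le> \<P>(w in M \<beta> x2. hitting_time (X \<beta>) {x0} w < hitting_time (X \<beta>) {x1 1} w)"
      using irreducible_chain_eventually eventually_gt_at_top[of 0]
    proof eventually_elim
      case (elim \<beta>)
      show ?case unfolding g_def
        by (rule equilibrium_le_hitting_prob[OF elim(1) chain[OF elim(2)]]) (use A x1A assms(6) in auto)
    qed
    show "((\<lambda>\<beta>. \<P>(w in M \<beta> x2. hitting_time (X \<beta>) {x0} w < hitting_time (X \<beta>) {x1 1} w)) \<longlongrightarrow> 0) at_top"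
      by (rule assms(12)[OF one])
  qed

  \<comment> \<open>Joining the two stages from \<open>x2\<close> to \<open>x0\<close>\<close>
  have lim: "((\<lambda>\<beta>. exp (- \<beta> * \<gamma>) * u \<beta> x2) \<longlongrightarrow> 1 / k1 + 1 / k2) at_top"
  proof (rule tendsto_sandwich)
    let ?e = "\<lambda>\<beta>. exp (- \<beta> * \<gamma>)"
    \<comment> \<open>The second stage costs between \<open>u \<beta> a - \<delta> \<beta>\<close>
      and \<open>u \<beta> a + \<delta> \<beta>\<close> from any state of \<open>A\<close>; in the
      lower bound it is weighted by \<open>1 - g \<beta>\<close>, as the chain may enter at
      \<open>x0\<close>.\<close>
    have "\<forall>\<^sub>F \<beta> in at_top. v \<beta> + (u \<beta> a - \<delta> \<beta>) * (1 - g \<beta>) \<le> u \<beta> x2 \<and> u \<beta> x2 \<le> v \<beta> + (u \<beta> a + \<delta> \<beta>)"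
      using irreducible_chain_eventually near nonneg
    proof eventually_elim
      case (elim \<beta>)
      interpret irreducible_chain "P \<beta>" by fact
      have "0 \<le> u \<beta> a + \<delta> \<beta>" using elim(2,4) a by (meson order_trans)
      then show ?case
        using mean_hitting_lower[of "{x0}" A "u \<beta> a - \<delta> \<beta>" x2]
          mean_hitting_upper[of "{x0}" "u \<beta> a + \<delta> \<beta>" A x2] elim(2) A
        by (simp add: u_def v_def g_def)
    qed
    then have *: "\<forall>\<^sub>F \<beta> in at_top.
        ?e \<beta> * v \<beta> + (?e \<beta> * u \<beta> a - ?e \<beta> * \<delta> \<beta>) * (1 - g \<beta>) \<le> ?e \<beta> * u \<beta> x2 \<and>
        ?e \<beta> * u \<beta> x2 \<le> ?e \<beta> * v \<beta> + (?e \<beta> * u \<beta> a + ?e \<beta> * \<delta> \<beta>)"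
      by eventually_elim (simp add: mult.assoc flip: distrib_left right_diff_distrib)
    show "\<forall>\<^sub>F \<beta> in at_top. ?e \<beta> * v \<beta> + (?e \<beta> * u \<beta> a - ?e \<beta> * \<delta> \<beta>) * (1 - g \<beta>) \<le> ?e \<beta> * u \<beta> x2"
      "\<forall>\<^sub>F \<beta> in at_top. ?e \<beta> * u \<beta> x2 \<le> ?e \<beta> * v \<beta> + (?e \<beta> * u \<beta> a + ?e \<beta> * \<delta> \<beta>)"
      using * by (auto elim: eventually_mono)
    have "((\<lambda>\<beta>. ?e \<beta> * v \<beta> + (?e \<beta> * u \<beta> a - ?e \<beta> * \<delta> \<beta>) * (1 - g \<beta>)) \<longlongrightarrow>
        1 / k1 + (1 / k2 - 0) * (1 - 0)) at_top"
      by (intro tendsto_intros v_lim u_lim \<delta>_lim g_lim)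
    then show "((\<lambda>\<beta>. ?e \<beta> * v \<beta> + (?e \<beta> * u \<beta> a - ?e \<beta> * \<delta> \<beta>) * (1 - g \<beta>)) \<longlongrightarrow> 1 / k1 + 1 / k2) at_top"
      by simp
    have "((\<lambda>\<beta>. ?e \<beta> * v \<beta> + (?e \<beta> * u \<beta> a + ?e \<beta> * \<delta> \<beta>)) \<longlongrightarrow> 1 / k1 + (1 / k2 + 0)) at_top"
      by (intro tendsto_intros v_lim u_lim \<delta>_lim)
    then show "((\<lambda>\<beta>. ?e \<beta> * v \<beta> + (?e \<beta> * u \<beta> a + ?e \<beta> * \<delta> \<beta>)) \<longlongrightarrow> 1 / k1 + 1 / k2) at_top"
      by simp
  qed

  \<comment> \<open>Return to the probabilistic hitting time\<close>
  have expected: "\<forall>\<^sub>F \<beta> in at_top. expected_hitting_time (M \<beta> x2) (X \<beta>) {x0} = ennreal (u \<beta> x2)"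
    using irreducible_chain_eventually eventually_gt_at_top[of 0]
  proof eventually_elim
    case (elim \<beta>)
    interpret markov_hitting "P \<beta>" "M \<beta> x2" "X \<beta>" x2 "{x0}"
      using elim chain[OF elim(2)] assms(6) by (simp add: markov_hitting_def markov_hitting_axioms_def)
    show ?case unfolding u_def by (rule expected_hitting_time_eq)
  qed
  have K: "1 / k1 + 1 / k2 > 0" using assms(13,14) by (simp add: add_pos_pos)
  have "((\<lambda>\<beta>. exp (- \<beta> * \<gamma>) * u \<beta> x2 / (1 / k1 + 1 / k2)) \<longlongrightarrow> (1 / k1 + 1 / k2) / (1 / k1 + 1 / k2)) at_top"
    by (rule tendsto_divide[OF lim tendsto_const]) (use K in simp)
  then have ratio: "((\<lambda>\<beta>. exp (- \<beta> * \<gamma>) * u \<beta> x2 / (1 / k1 + 1 / k2)) \<longlongrightarrow> 1) at_top" using K by simp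
  have "\<forall>\<^sub>F \<beta> in at_top. exp (- \<beta> * \<gamma>) * u \<beta> x2 / (1 / k1 + 1 / k2) =
      enn2real (expected_hitting_time (M \<beta> x2) (X \<beta>) {x0}) / (exp (\<beta> * \<gamma>) * (1 / k1 + 1 / k2))"
    using expected nonneg(2)
  proof eventually_elim
    case (elim \<beta>)
    then have "enn2real (expected_hitting_time (M \<beta> x2) (X \<beta>) {x0}) = u \<beta> x2" by simp
    then show ?case by (simp add: exp_minus divide_inverse)
  qed
  from Lim_transform_eventually[OF ratio this]
  have "(\<lambda>\<beta>. enn2real (expected_hitting_time (M \<beta> x2) (X \<beta>) {x0}))
      \<sim>[at_top] (\<lambda>\<beta>. exp (\<beta> * real_of_ereal (max_stability_level H \<Delta>)) * (1 / k1 + 1 / k2))"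
    unfolding \<gamma> by (intro asymp_equivI') simp
  moreover have "\<forall>\<^sub>F \<beta> in at_top. expected_hitting_time (M \<beta> x2) (X \<beta>) {x0} < \<infinity>"
    using expected by eventually_elim simp
  ultimately show ?thesis by blast
qed

end
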